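(* Let $p\geq 2$ be an integer and let $G$ be a planar graph. Then $\mathrm{id}^{\leq p}(G)\leq \left\lceil\frac{|E(G)|}{\lfloor p/2\rfloor}\right\rceil + 8\lfloor p/2\rfloor - 8$. In particular, every planar graph $G$ of order $n\ge 3$ satisfies $\mathrm{id}^{\leq p}(G)\le \left\lceil\frac{3n-6}{\lfloor p/2\rfloor}\right\rceil + 8\lfloor p/2\rfloor - 8$.
   Context: All graphs are finite and simple. For an oriented graph $D$ and a set $X\subseteq V(D)$, the inversion of $X$ reverses the orientation of every arc with both endvertices in $X$. For an integer $p\ge 2$, a $(\leq p)$-inversion is the inversion of a set of at most $p$ vertices. For a graph $G$, $\mathrm{id}^{\leq p}(G)$ (the $(\leq p)$-inversion diameter) is the maximum, over all ordered pairs $(\vec G_1,\vec G_2)$ of orientations of $G$ (on the same labelled vertex set), of the minimum number of $(\leq p)$-inversions whose successive application transforms $\vec G_1$ into $\vec G_2$. *)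

theory Defs
  imports "HOL-Analysis.Analysis"
begin

definition simple_graph :: "'a set \<Rightarrow> 'a set set \<Rightarrow> bool" where
  "simple_graph V E \<longleftrightarrow> finite V \<and> (\<forall>e\<in>E. e \<subseteq> V \<and> card e = 2)"

definition planar :: "'a set \<Rightarrow> 'a set set \<Rightarrow> bool" where
  "planar V E \<longleftrightarrow> (\<exists>(f :: 'a \<Rightarrow> complex) (\<Gamma> :: 'a set \<Rightarrow> real \<Rightarrow> complex).
      inj_on f V \<and>
      (\<forall>e\<in>E. arc (\<Gamma> e) \<and> {pathstart (\<Gamma> e), pathfinish (\<Gamma> e)} = f ` e) \<and>
      (\<forall>e\<in>E. \<forall>v\<in>V. f v \<in> path_image (\<Gamma> e) \<longrightarrow> v \<in> e) \<and>
      (\<forall>e\<in>E. \<forall>e'\<in>E. e \<noteq> e' \<longrightarrow> path_image (\<Gamma> e) \<inter> path_image (\<Gamma> e') \<subseteq> f ` (e \<inter> e')))"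

definition orientation :: "'a set set \<Rightarrow> ('a \<times> 'a) set \<Rightarrow> bool" where
  "orientation E A \<longleftrightarrow> (\<forall>(u,v)\<in>A. {u,v} \<in> E) \<and>
     (\<forall>u v. {u,v} \<in> E \<longrightarrow> ((u,v) \<in> A \<longleftrightarrow> (v,u) \<notin> A))"

definition invert :: "('a \<times> 'a) set \<Rightarrow> 'a set \<Rightarrow> ('a \<times> 'a) set" where
  "invert A X = {(u,v). ((u,v) \<in> A \<and> \<not> (u \<in> X \<and> v \<in> X)) \<or> ((v,u) \<in> A \<and> u \<in> X \<and> v \<in> X)}"

definition inv_dist :: "nat \<Rightarrow> 'a set \<Rightarrow> ('a \<times> 'a) set \<Rightarrow> ('a \<times> 'a) set \<Rightarrow> nat" where
  "inv_dist p V A1 A2 = (LEAST k. \<exists>Xs. length Xs = k \<and>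
      (\<forall>X\<in>set Xs. X \<subseteq> V \<and> card X \<le> p) \<and> foldl invert A1 Xs = A2)"

definition inv_diam :: "nat \<Rightarrow> 'a set \<Rightarrow> 'a set set \<Rightarrow> nat" where
  "inv_diam p V E = Max {inv_dist p V A1 A2 | A1 A2. orientation E A1 \<and> orientation E A2}"

end

(* Put q = p div 2. A vertex of degree d \<ge> q is removed by (d div q) inversions of the vertex together
   with chunks of neighbours: all later inversions avoid the vertex, so whatever these chunks do to
   the other edges is repaired there. This leaves maximum degree at most q - 1.

   Now order the vertices with at most k earlier neighbours each and assign every edge to one of
   M + k(q - 1) inversions, at most q edges to each. When a vertex v is reached, it joins the
   inversions assigned to its edges to later vertices, while each edge to an earlier vertex leaves a
   free choice: join its inversion or not. Forbidding k(q - 1) inversions per edge makes the effect of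
   these choices on the earlier edges at v triangular, so the parities of all of them can be prescribed.

   For a planar graph k = 5 by Euler's formula, which is obtained topologically: the Jordan curve
   theorem gives many faces, and Janiszewski's theorem shows that an edge borders at most two. *)

theory Submission
  imports Defs
begin

section \<open>Prescribing parities by small inversions\<close>

text \<open>Greedy choice in the order of \<open>r\<close>. Conflicts point only to elements of
  smaller rank, so the element placed last has at most K colours excluded by conflicts, while fewer
  than M colours already have q elements. One of the M + K colours is left.\<close>

lemma greedy_bounded_coloring:
  fixes r :: "'e \<Rightarrow> nat"
  assumes "finite S" "card S \<le> q * M"
    and "\<And>e f. e \<in> S \<Longrightarrow> f \<in> conf e \<Longrightarrow> r f < r e"
    and "\<And>e. e \<in> S \<Longrightarrow> finite (conf e) \<and> card (conf e) \<le> K"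
  shows "\<exists>c. (\<forall>e\<in>S. c e < M + K) \<and> (\<forall>e\<in>S. \<forall>f\<in>conf e \<inter> S. c f \<noteq> c e) \<and>
             (\<forall>i::nat. card {e\<in>S. c e = i} \<le> q)"
  using assms
proof (induction S rule: finite_ranking_induct[where f = r])
  case empty
  then show ?case by simp
next
  case (insert a S)
  show ?case
  proof (cases "a \<in> S")
    case True
    then show ?thesis using insert.IH insert.prems by (simp add: insert_absorb)
  next
    case False
    have "card S \<le> q * M" using insert False by simp
    then obtain c where c: "\<forall>e\<in>S. c e < M + K" "\<forall>e\<in>S. \<forall>f\<in>conf e \<inter> S. c f \<noteq> c e"
      "\<forall>i. card {e\<in>S. c e = i} \<le> q"
      using insert by auto
    define full where "full = {i \<in> {..<M+K}. card {e\<in>S. c e = i} = q}"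
    \<comment> \<open>Full classes are disjoint and take q elements each, and fewer than q * M
      elements have been placed.\<close>
    have "q * card full = (\<Sum>i\<in>full. card {e\<in>S. c e = i})"
      by (simp add: full_def)
    also have "\<dots> = card (\<Union>i\<in>full. {e\<in>S. c e = i})"
      using \<open>finite S\<close> by (subst card_UN_disjoint) (auto simp: full_def)
    also have "\<dots> \<le> card S"
      using \<open>finite S\<close> by (intro card_mono) auto
    also have "\<dots> < q * M" using insert.prems(1) False \<open>finite S\<close> by simp
    finally have full: "card full < M" by simp
    have fin: "finite (conf a)" and K: "card (conf a) \<le> K" using insert.prems(3) by auto
    have "card (full \<union> c ` conf a) \<le> card full + card (c ` conf a)" by (rule card_Un_le)
    also have "\<dots> < M + K" using full card_image_le[OF fin, of c] K by linarith
    finally have "card (full \<union> c ` conf a) < card {..<M+K}" by simp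
    then have "\<not> {..<M+K} \<subseteq> full \<union> c ` conf a"
      using fin card_mono[of "full \<union> c ` conf a" "{..<M+K}"] by (auto simp: full_def)
    then obtain i where i: "i < M + K" "i \<notin> full" "i \<notin> c ` conf a" by auto
    have iq: "card {e\<in>S. c e = i} < q" using i c(3) by (auto simp: full_def le_less)
    define c' where "c' = c(a := i)"
    \<comment> \<open>The new element is in nobody's conflict set, so colouring it cannot spoil what
      was achieved before.\<close>
    have na: "a \<notin> conf e" if "e \<in> insert a S" for e
      using insert.prems(2)[OF that, of a] insert.hyps(2) that by fastforce
    have "card {e\<in>insert a S. c' e = j} \<le> q" for j
    proof (cases "j = i")
      case True
      have "{e\<in>insert a S. c' e = j} = insert a {e\<in>S. c e = i}"
        using False True by (auto simp: c'_def)
      then show ?thesis using iq \<open>finite S\<close> False by simp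
    next
      case ne: False
      have "{e\<in>insert a S. c' e = j} = {e\<in>S. c e = j}"
        using False ne by (auto simp: c'_def)
      then show ?thesis using c by simp
    qed
    moreover have "\<forall>e\<in>insert a S. \<forall>f\<in>conf e \<inter> insert a S. c' f \<noteq> c' e"
      using na c(2) i False by (auto simp: c'_def)
    moreover have "\<forall>e\<in>insert a S. c' e < M + K" using c i by (auto simp: c'_def)
    ultimately show ?thesis by blast
  qed
qed

text \<open>Over the field with two elements, the matrix of the incidences
  \<open>h y \<in> m x\<close> is triangular with ones on the diagonal. Going up in
  \<open>r\<close>, adding \<open>h a\<close> to \<open>T\<close> toggles the parity at
  \<open>a\<close> and at no smaller element. \<open>R\<close> is the part of the solution that is
  fixed in advance.\<close>

lemma triangular_parity_solution:
  fixes r :: "'a \<Rightarrow> nat" and h :: "'a \<Rightarrow> nat"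
  assumes "finite L" "inj_on r L" "finite R"
    and "\<And>x. x \<in> L \<Longrightarrow> h x \<in> m x - R"
    and "\<And>x y. x \<in> L \<Longrightarrow> y \<in> L \<Longrightarrow> r x < r y \<Longrightarrow> h y \<notin> m x"
  shows "\<exists>T\<subseteq>h ` L. \<forall>x\<in>L. odd (card (m x \<inter> (R \<union> T))) \<longleftrightarrow> b x"
  using assms
proof (induction L rule: finite_ranking_induct[where f = r])
  case empty
  then show ?case by simp
next
  case (insert a L)
  show ?case
  proof (cases "a \<in> L")
    case True
    then show ?thesis using insert.IH insert.prems by (simp add: insert_absorb)
  next
    case False
    have lt: "r x < r a" if "x \<in> L" for x
      using insert.hyps(2)[OF that] insert.prems(1) False that
      by (metis inj_onD insertCI le_neq_implies_less)
    obtain T where T: "T \<subseteq> h ` L" "\<forall>x\<in>L. odd (card (m x \<inter> (R \<union> T))) \<longleftrightarrow> b x"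
      using insert.IH insert.prems by (auto simp: inj_on_insert)
    have finT: "finite T" using T(1) insert.hyps(1) finite_surj by blast
    show ?thesis
    proof (cases "odd (card (m a \<inter> (R \<union> T))) \<longleftrightarrow> b a")
      case True
      then show ?thesis using T by auto
    next
      case ne: False
      \<comment> \<open>Each earlier \<open>h x\<close> lies in \<open>m x\<close> and
        \<open>h a\<close> does not, so \<open>h a\<close> is new and the count grows by exactly
        one.\<close>
      have "h a \<notin> h ` L" using lt insert.prems(3,4) by fastforce
      then have nin: "h a \<notin> R \<union> T" using T(1) insert.prems(3) by auto
      have "m a \<inter> (R \<union> insert (h a) T) = insert (h a) (m a \<inter> (R \<union> T))"
        using insert.prems(3) by auto
      then have "card (m a \<inter> (R \<union> insert (h a) T)) = Suc (card (m a \<inter> (R \<union> T)))"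
        using nin finT insert.prems(2) by simp
      moreover have "m x \<inter> (R \<union> insert (h a) T) = m x \<inter> (R \<union> T)" if "x \<in> L" for x
        using insert.prems(4)[of x a] lt that by auto
      ultimately have "\<forall>x\<in>insert a L. odd (card (m x \<inter> (R \<union> insert (h a) T))) \<longleftrightarrow> b x"
        using T ne by simp
      moreover have "insert (h a) T \<subseteq> h ` insert a L" using T by auto
      ultimately show ?thesis by blast
    qed
  qed
qed

text \<open>\<open>c e\<close> is the inversion that edge \<open>e\<close> is assigned to, and \<open>mem v\<close> is the set of inversions that
  contain \<open>v\<close>.\<close>

lemma memberships_from_coloring:
  fixes r :: "'a \<Rightarrow> nat" and c :: "'a set \<Rightarrow> nat"
  assumes "finite V" "inj_on r V" "finite E" 
    and EV: "\<And>e. e \<in> E \<Longrightarrow> e \<subseteq> V \<and> card e = 2"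
    and c1: "\<And>x v w e. {x,w} \<in> E \<Longrightarrow> {v,w} \<in> E \<Longrightarrow> r x < r v \<Longrightarrow> r v < r w \<Longrightarrow>
               e \<in> E \<Longrightarrow> x \<in> e \<Longrightarrow> c {v,w} \<noteq> c e"
    and c2: "\<And>u v w. {u,v} \<in> E \<Longrightarrow> {v,w} \<in> E \<Longrightarrow> r u < r v \<Longrightarrow> r v < r w \<Longrightarrow> c {u,v} \<noteq> c {v,w}"
  shows "\<exists>mem. (\<forall>v\<in>V. mem v \<subseteq> c ` {e\<in>E. v \<in> e}) \<and>
    (\<forall>u\<in>V. \<forall>v\<in>V. {u,v} \<in> E \<longrightarrow> (odd (card (mem u \<inter> mem v)) \<longleftrightarrow> {u,v} \<in> F))"
proof -
  \<comment> \<open>The first conjunct is the invariant behind the free choices: a processed vertex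
    is already in the inversion of each of its edges to later vertices, whether or not these have
    been processed.\<close>
  have "\<exists>mem. (\<forall>v\<in>P. (\<lambda>w. c {v,w}) ` {w. {v,w} \<in> E \<and> r v < r w} \<subseteq> mem v) \<and>
         (\<forall>v\<in>P. mem v \<subseteq> c ` {e\<in>E. v \<in> e}) \<and>
         (\<forall>u\<in>P. \<forall>v\<in>P. {u,v} \<in> E \<longrightarrow> (odd (card (mem u \<inter> mem v)) \<longleftrightarrow> {u,v} \<in> F))"
    if "finite P" "P \<subseteq> V" for P
    using that
  proof (induction P rule: finite_ranking_induct[where f = r])
    case empty
    then show ?case by simp
  next
    case (insert a P)
    show ?case
    proof (cases "a \<in> P")
      case True
      then show ?thesis using insert.IH insert.prems by (simp add: insert_absorb)
    next
      case False
      obtain mem where mem: "\<And>v w. v \<in> P \<Longrightarrow> {v,w} \<in> E \<Longrightarrow> r v < r w \<Longrightarrow> c {v,w} \<in> mem v"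
        "\<And>v. v \<in> P \<Longrightarrow> mem v \<subseteq> c ` {e\<in>E. v \<in> e}"
        "\<And>u v. u \<in> P \<Longrightarrow> v \<in> P \<Longrightarrow> {u,v} \<in> E \<Longrightarrow> (odd (card (mem u \<inter> mem v)) \<longleftrightarrow> {u,v} \<in> F)"
      proof -
        have "P \<subseteq> V" using insert.prems by simp
        from insert.IH[OF this] obtain mem where
          m: "\<forall>v\<in>P. (\<lambda>w. c {v,w}) ` {w. {v,w} \<in> E \<and> r v < r w} \<subseteq> mem v"
          "\<forall>v\<in>P. mem v \<subseteq> c ` {e\<in>E. v \<in> e}"
          "\<forall>u\<in>P. \<forall>v\<in>P. {u,v} \<in> E \<longrightarrow> (odd (card (mem u \<inter> mem v)) \<longleftrightarrow> {u,v} \<in> F)"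
          by (elim exE conjE)
        show thesis
        proof (rule that[of mem])
          show "c {v,w} \<in> mem v" if "v \<in> P" "{v,w} \<in> E" "r v < r w" for v w
            using m(1) that by blast
        qed (simp_all add: m(2,3))
      qed
      have lt: "r x < r a" if "x \<in> P" for x
      proof -
        have "r x \<noteq> r a" using insert.prems \<open>inj_on r V\<close> False that by (auto dest!: inj_onD)
        then show ?thesis using insert.hyps(2)[OF that] by simp
      qed
      \<comment> \<open>\<open>R\<close> collects the memberships that the invariant forces on
        \<open>a\<close>; the free ones are sought among the colours of the edges to earlier
        neighbours.\<close>
      define R where "R = (\<lambda>w. c {a,w}) ` {w. {a,w} \<in> E \<and> r a < r w}"
      have RE: "R \<subseteq> c ` {e\<in>E. a \<in> e}" by (auto simp: R_def)
      then have finR: "finite R" using \<open>finite E\<close> finite_subset by fastforce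
      define L where "L = {x\<in>P. {x,a} \<in> E}"
      have "\<exists>T\<subseteq>(\<lambda>x. c {x,a}) ` L. \<forall>x\<in>L. odd (card (mem x \<inter> (R \<union> T))) \<longleftrightarrow> {x,a} \<in> F"
      proof (rule triangular_parity_solution)
        show "finite L" using insert.hyps by (simp add: L_def)
        show "inj_on r L" using \<open>inj_on r V\<close> insert.prems by (auto simp: L_def inj_on_def)
        \<comment> \<open>The invariant at \<open>x\<close> puts this colour into
          \<open>mem x\<close>, and \<open>c2\<close> keeps it out of \<open>R\<close>.\<close>
        show "c {x,a} \<in> mem x - R" if "x \<in> L" for x
          using that mem(1) lt c2 by (fastforce simp: L_def R_def)
        \<comment> \<open>Triangularity: \<open>mem x\<close> holds only colours of edges at
          \<open>x\<close>, and \<open>c1\<close> separates the colour of \<open>{y,a}\<close> from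
          those.\<close>
        show "c {y,a} \<notin> mem x" if "x \<in> L" "y \<in> L" "r x < r y" for x y
          using that mem(2)[of x] lt c1[of x a y] by (fastforce simp: L_def)
      qed fact
      then obtain T where T: "T \<subseteq> (\<lambda>x. c {x,a}) ` L"
        "\<And>x. x \<in> L \<Longrightarrow> odd (card (mem x \<inter> (R \<union> T))) \<longleftrightarrow> {x,a} \<in> F" by auto
      define mem' where "mem' = mem(a := R \<union> T)"
      have TE: "T \<subseteq> c ` {e\<in>E. a \<in> e}" using T(1) by (auto simp: L_def)
      have naa: "{a,a} \<notin> E" using EV[of "{a,a}"] by auto
      have 1: "(\<lambda>w. c {v,w}) ` {w. {v,w} \<in> E \<and> r v < r w} \<subseteq> mem' v" if "v \<in> insert a P" for v
        using that mem(1) False by (auto simp: mem'_def R_def)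
      have 2: "mem' v \<subseteq> c ` {e\<in>E. v \<in> e}" if "v \<in> insert a P" for v
        using that mem(2) RE TE False by (auto simp: mem'_def)
      have 3: "odd (card (mem' u \<inter> mem' v)) \<longleftrightarrow> {u,v} \<in> F"
        if uv: "u \<in> insert a P" "v \<in> insert a P" "{u,v} \<in> E" for u v
      proof -
        have "\<not> (u = a \<and> v = a)" using uv naa by auto
        then
        consider "u \<in> P" "v \<in> P" | "u = a" "v \<in> P" | "u \<in> P" "v = a"
          using uv by blast
        then show ?thesis
        proof cases
          case 1
          then show ?thesis using mem(3)[of u v] False that by (auto simp: mem'_def)
        next
          case 2
          then show ?thesis using T(2)[of v] False that
            by (auto simp: mem'_def L_def insert_commute Int_commute)
        next
          case 3
          then show ?thesis using T(2)[of u] False that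
            by (auto simp: mem'_def L_def)
        qed
      qed
      show ?thesis by (intro exI[of _ mem'] conjI ballI impI) (fact 1 2 3)+
    qed
  qed
  from this[OF \<open>finite V\<close> order_refl] show ?thesis by blast
qed

section \<open>Flipping a prescribed set of edges of a degenerate graph\<close>

text \<open>An inversion reverses an edge exactly if its set contains both ends, so only the parity
  of this count matters and orientations can be set aside until the end.\<close>

definition flip_count :: "'a set list \<Rightarrow> 'a set \<Rightarrow> nat" where
  "flip_count Xs e = length (filter (\<lambda>X. e \<subseteq> X) Xs)"

lemma flip_count_append: "flip_count (Xs @ Ys) e = flip_count Xs e + flip_count Ys e"
  by (simp add: flip_count_def)

text \<open>Here \<open>Suc d\<close> plays the role of q: a colour class of at most
  \<open>Suc d\<close> edges covers at most \<open>2 * Suc d\<close> vertices. The conflicts needed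
  for the memberships number at most \<open>k * d\<close> per edge, which is the additive
  term.\<close>

lemma flips_of_small_degree_graph:
  fixes r :: "'a \<Rightarrow> nat"
  assumes G: "simple_graph V E" and r: "inj_on r V"
    and left: "\<And>v. v \<in> V \<Longrightarrow> card {u. {u,v} \<in> E \<and> r u < r v} \<le> k"
    and deg: "\<And>v. v \<in> V \<Longrightarrow> card {e\<in>E. v \<in> e} \<le> d"
    and M: "card E \<le> Suc d * M"
  shows "\<exists>Xs. length Xs = M + k * d \<and> (\<forall>X\<in>set Xs. X \<subseteq> V \<and> card X \<le> 2 * Suc d) \<and>
              (\<forall>e\<in>E. odd (flip_count Xs e) \<longleftrightarrow> e \<in> F)"
proof -
  have finV: "finite V" and EV: "\<And>e. e \<in> E \<Longrightarrow> e \<subseteq> V \<and> card e = 2"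
    using G by (auto simp: simple_graph_def)
  have finE: "finite E" using finV EV finite_subset[of E "Pow V"] by auto
  \<comment> \<open>With \<open>v\<close> the earlier and \<open>w\<close> the later end of
    \<open>e\<close>, the two alternatives provide \<open>c1\<close> and \<open>c2\<close> of
    \<open>memberships_from_coloring\<close>.\<close>
  define conf where "conf e = {f\<in>E. \<exists>v w. e = {v,w} \<and> r v < r w \<and>
    ((\<exists>x. {x,w} \<in> E \<and> r x < r v \<and> x \<in> f) \<or> (\<exists>u. f = {u,v} \<and> r u < r v))}" for e
  have *: "\<exists>v w. e = {v,w} \<and> v \<in> V \<and> w \<in> V \<and> r v < r w" if "e \<in> E" for e
  proof -
    obtain v w where vw: "e = {v,w}" "v \<noteq> w" using EV[OF \<open>e \<in> E\<close>] by (auto simp: card_2_iff)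
    then have "v \<in> V" "w \<in> V" using EV[OF that] by auto
    moreover from this have "r v \<noteq> r w" using r vw by (auto dest: inj_onD)
    ultimately show ?thesis using vw by (metis insert_commute nat_neq_iff)
  qed
  \<comment> \<open>Edges are ranked by their earlier end; a conflicting edge always has an end
    before \<open>v\<close>.\<close>
  have Min_less: "Min (r ` f) < Min (r ` e)" if "e \<in> E" "f \<in> conf e" for e f
  proof -
    obtain v w where vw: "e = {v,w}" "r v < r w" and
      f: "(\<exists>x. {x,w} \<in> E \<and> r x < r v \<and> x \<in> f) \<or> (\<exists>u. f = {u,v} \<and> r u < r v)" "f \<in> E"
      using \<open>f \<in> conf e\<close> unfolding conf_def by blast
    from f obtain x where "x \<in> f" "r x < r v" by auto
    moreover have "finite f" using EV f finV finite_subset by blast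
    ultimately have "Min (r ` f) < r v" by (meson Min_le finite_imageI image_eqI le_less_trans)
    then show ?thesis using vw by auto
  qed
  have conf_card: "card (conf e) \<le> k * d" if "e \<in> E" for e
  proof -
    obtain v w where vw: "e = {v,w}" "v \<in> V" "w \<in> V" "r v < r w" using *[OF \<open>e \<in> E\<close>] by blast
    define B where "B = {x. {x,w} \<in> E \<and> r x < r w}"
    have finB: "finite B" using EV finV by (auto simp: B_def intro!: finite_subset[of _ V])
    have vB: "v \<in> B" using vw that by (auto simp: B_def)
    have dv: "card ({e\<in>E. v \<in> e} - {e}) \<le> d"
      using deg[OF vw(2)] by (meson card_Diff1_le le_trans)
    have fdeg: "finite {e\<in>E. x \<in> e}" for x using finE by simp
    \<comment> \<open>At most d conflicts arise at \<open>v\<close>, and at most d at each other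
      earlier neighbour of \<open>w\<close>. As \<open>v\<close> is itself one of the at most k
      earlier neighbours, the total is at most \<open>k * d\<close>.\<close>
    have sub: "conf e \<subseteq> ({e\<in>E. v \<in> e} - {e}) \<union> (\<Union>x\<in>B-{v}. {e\<in>E. x \<in> e})"
    proof
      fix f assume "f \<in> conf e"
      then obtain v' w' where vw': "e = {v',w'}" "r v' < r w'" "f \<in> E" and
         f: "(\<exists>x. {x,w'} \<in> E \<and> r x < r v' \<and> x \<in> f) \<or> (\<exists>u. f = {u,v'} \<and> r u < r v')"
        by (auto simp: conf_def)
      have "v' = v" "w' = w" using vw vw' by (auto simp: doubleton_eq_iff)
      show "f \<in> ({e\<in>E. v \<in> e} - {e}) \<union> (\<Union>x\<in>B-{v}. {e\<in>E. x \<in> e})"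
        using f
      proof (elim disjE exE conjE)
        fix x assume "{x,w'} \<in> E" "r x < r v'" "x \<in> f"
        then have "x \<in> B - {v}" using \<open>v' = v\<close> \<open>w' = w\<close> vw by (auto simp: B_def)
        then show ?thesis using \<open>x \<in> f\<close> \<open>f \<in> E\<close> by blast
      next
        fix u assume u: "f = {u,v'}" "r u < r v'"
        then have "w \<notin> f" using \<open>v' = v\<close> vw by auto
        then show ?thesis using u \<open>v' = v\<close> \<open>f \<in> E\<close> vw by auto
      qed
    qed
    have "card (conf e) \<le> card (({e\<in>E. v \<in> e} - {e}) \<union> (\<Union>x\<in>B-{v}. {e\<in>E. x \<in> e}))"
      using sub finE finB by (intro card_mono) auto
    also have "\<dots> \<le> card ({e\<in>E. v \<in> e} - {e}) + (\<Sum>x\<in>B-{v}. card {e\<in>E. x \<in> e})"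
      using card_Un_le card_UN_le[of "B - {v}" "\<lambda>x. {e\<in>E. x \<in> e}"] finB
      by (metis (no_types, lifting) add_left_mono finite_Diff le_trans)
    also have "(\<Sum>x\<in>B-{v}. card {e\<in>E. x \<in> e}) \<le> (\<Sum>x\<in>B-{v}. d)"
      using deg EV by (intro sum_mono) (auto simp: B_def)
    also have "card ({e\<in>E. v \<in> e} - {e}) + \<dots> \<le> d + (card B - 1) * d"
      using dv vB finB by simp
    also have "\<dots> = card B * d"
      using vB finB by (metis card_gt_0_iff empty_iff mult.commute mult_eq_if not_gr_zero)
    also have "\<dots> \<le> k * d" using left[OF vw(3)] by (auto simp: B_def)
    finally show ?thesis by simp
  qed
  obtain c where c: "\<forall>e\<in>E. c e < M + k * d" "\<forall>e\<in>E. \<forall>f\<in>conf e \<inter> E. c f \<noteq> c e"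
    "\<forall>i::nat. card {e\<in>E. c e = i} \<le> Suc d"
    using greedy_bounded_coloring[OF finE M, of conf "\<lambda>e. Min (r ` e)" "k * d"]
      Min_less conf_card finE by (auto simp: conf_def)
  obtain mem where mem: "\<And>v. v \<in> V \<Longrightarrow> mem v \<subseteq> c ` {e\<in>E. v \<in> e}"
    "\<And>u v. u \<in> V \<Longrightarrow> v \<in> V \<Longrightarrow> {u,v} \<in> E \<Longrightarrow> (odd (card (mem u \<inter> mem v)) \<longleftrightarrow> {u,v} \<in> F)"
  proof -
    have "\<exists>mem. (\<forall>v\<in>V. mem v \<subseteq> c ` {e\<in>E. v \<in> e}) \<and>
      (\<forall>u\<in>V. \<forall>v\<in>V. {u,v} \<in> E \<longrightarrow> (odd (card (mem u \<inter> mem v)) \<longleftrightarrow> {u,v} \<in> F))"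
    proof (rule memberships_from_coloring[OF finV r finE EV])
      show "c {v,w} \<noteq> c e" if "{x,w} \<in> E" "{v,w} \<in> E" "r x < r v" "r v < r w" "e \<in> E" "x \<in> e"
        for x v w e
      proof -
        have "e \<in> conf {v,w}" using that by (auto simp: conf_def)
        then show ?thesis using c(2) that by fastforce
      qed
      show "c {u,v} \<noteq> c {v,w}" if "{u,v} \<in> E" "{v,w} \<in> E" "r u < r v" "r v < r w" for u v w
      proof -
        have "{u,v} \<in> conf {v,w}" using that by (auto simp: conf_def)
        then show ?thesis using c(2) that by fastforce
      qed
    qed
    then show ?thesis using that by blast
  qed
  define X where "X i = {v\<in>V. i \<in> mem v}" for i
  define Xs where "Xs = map X [0..<M + k * d]"
  have "card (X i) \<le> 2 * Suc d" for i
  proof -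
    \<comment> \<open>A vertex joins only inversions assigned to its own edges, so the edges of
      colour \<open>i\<close> cover \<open>X i\<close>.\<close>
    have "X i \<subseteq> \<Union>{e\<in>E. c e = i}" using mem(1) by (fastforce simp: X_def)
    then have "card (X i) \<le> card (\<Union>{e\<in>E. c e = i})"
      using finE EV finV by (intro card_mono finite_Union) (auto intro: finite_subset)
    also have "\<dots> \<le> (\<Sum>e\<in>{e\<in>E. c e = i}. card e)"
      by (rule card_Union_le_sum_card)
    also have "\<dots> \<le> (\<Sum>e\<in>{e\<in>E. c e = i}. 2)"
      using EV by (intro sum_mono) auto
    also have "\<dots> = 2 * card {e\<in>E. c e = i}" by simp
    also have "\<dots> \<le> 2 * Suc d" using c(3) by (intro mult_le_mono2) blast
    finally show ?thesis .
  qed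
  moreover have "odd (flip_count Xs e) \<longleftrightarrow> e \<in> F" if e: "e \<in> E" for e
  proof -
    obtain v w where vw: "e = {v,w}" "v \<in> V" "w \<in> V" using *[OF e] by blast
    have "mem v \<subseteq> {..<M + k * d}" using mem(1)[OF vw(2)] c(1) by auto
    then have "{i\<in>{0..<M+k*d}. e \<subseteq> X i} = mem v \<inter> mem w"
      using vw by (auto simp: X_def)
    then have "set (filter (\<lambda>i. e \<subseteq> X i) [0..<M + k * d]) = mem v \<inter> mem w"
      by (simp only: set_filter set_upt)
    then have "card (mem v \<inter> mem w) = length (filter (\<lambda>i. e \<subseteq> X i) [0..<M + k * d])"
      by (metis distinct_card distinct_filter distinct_upt)
    then have "flip_count Xs e = card (mem v \<inter> mem w)"
      by (simp add: flip_count_def Xs_def filter_map comp_def)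
    then show ?thesis using mem(2) vw e by simp
  qed
  moreover have "length Xs = M + k * d" by (simp add: Xs_def)
  ultimately show ?thesis by (intro exI[of _ Xs]) (auto simp: Xs_def X_def)
qed

text \<open>\<open>W\<close> is cut into chunks of at most s vertices, each inverted together with
  \<open>v\<close>, so every edge from \<open>v\<close> to \<open>W\<close> is reversed once. When
  \<open>W\<close> is used up, the remaining sets are just \<open>{v}\<close> and reverse nothing.
  Edges inside a chunk are not controlled.\<close>

lemma star_flips:
  assumes "finite W" "v \<notin> W" "W \<subseteq> N" "v \<notin> N" "card W \<le> a * s"
  shows "\<exists>Xs. length Xs = a \<and> (\<forall>X\<in>set Xs. X \<subseteq> insert v W \<and> card X \<le> Suc s) \<and>
              (\<forall>w\<in>N. odd (flip_count Xs {v,w}) \<longleftrightarrow> w \<in> W)"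
  using assms
proof (induction a arbitrary: W)
  case 0
  then show ?case by (auto simp: flip_count_def)
next
  case (Suc a)
  obtain U where U: "U \<subseteq> W" "card U = min s (card W)"
    by (meson obtain_subset_with_card_n min.cobounded2)
  have "card (W - U) \<le> a * s" using U Suc.prems by (simp add: card_Diff_subset finite_subset)
  then obtain Xs where Xs: "length Xs = a" "\<forall>X\<in>set Xs. X \<subseteq> insert v (W-U) \<and> card X \<le> Suc s"
    "\<forall>w\<in>N. odd (flip_count Xs {v,w}) \<longleftrightarrow> w \<in> W - U"
    using Suc.IH[of "W - U"] Suc.prems by auto
  have "finite U" using U Suc.prems finite_subset by blast
  then have "card (insert v U) \<le> Suc s" using U card_insert_le_m1[of "Suc s" U v] by simp
  moreover have "odd (flip_count (insert v U # Xs) {v,w}) \<longleftrightarrow> w \<in> W" if "w \<in> N" for w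
    using Xs(3) that U Suc.prems by (auto simp: flip_count_def)
  ultimately show ?case using Xs U by (intro exI[of _ "insert v U # Xs"]) auto
qed

text \<open>Removing a vertex of degree at least q lowers \<open>M\<close> by exactly the number of
  inversions spent on it, so the surplus \<open>k * (q - 1)\<close> is paid only once, when all
  degrees are at most q - 1.\<close>

theorem flips_of_degenerate_graph:
  fixes r :: "'a \<Rightarrow> nat"
  assumes "simple_graph V E" and "inj_on r V" "q \<ge> 1"
    and "\<And>v. v \<in> V \<Longrightarrow> card {u. {u,v} \<in> E \<and> r u < r v} \<le> k"
    and "card E \<le> q * M"
  shows "\<exists>Xs. length Xs = M + k * (q - 1) \<and> (\<forall>X\<in>set Xs. X \<subseteq> V \<and> card X \<le> 2 * q) \<and>
              (\<forall>e\<in>E. odd (flip_count Xs e) \<longleftrightarrow> e \<in> F)"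
  using assms
proof (induction "card E" arbitrary: V E F M rule: less_induct)
  case less
  note left = less.prems(4)
  have finV: "finite V" and EV: "\<And>e. e \<in> E \<Longrightarrow> e \<subseteq> V \<and> card e = 2"
    using less.prems(1) by (auto simp: simple_graph_def)
  have finE: "finite E" using finV EV finite_subset[of E "Pow V"] by auto
  show ?case
  proof (cases "\<exists>v\<in>V. q \<le> card {e\<in>E. v \<in> e}")
    case False
    then have "card {e\<in>E. v \<in> e} \<le> q - 1" if "v \<in> V" for v using that by fastforce
    then show ?thesis
      using flips_of_small_degree_graph[OF less.prems(1,2) left, of "q - 1" M F] less.prems(3,5)
      by simp
  next
    case True
    then obtain v where v: "v \<in> V" "q \<le> card {e\<in>E. v \<in> e}" by auto
    define S where "S = {e\<in>E. v \<in> e}"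
    define N where "N = {w. {v,w} \<in> E}"
    define a where "a = card S div q"
    define W where "W = {w\<in>N. {v,w} \<in> F}"
    have "v \<notin> N" using EV[of "{v}"] by (auto simp: N_def)
    have "N \<subseteq> V" using EV by (auto simp: N_def)
    then have finN: "finite N" using finV finite_subset by blast
    have S: "S = (\<lambda>w. {v,w}) ` N"
    proof
      show "S \<subseteq> (\<lambda>w. {v,w}) ` N"
      proof
        fix e assume "e \<in> S"
        then have e: "e \<in> E" "v \<in> e" by (auto simp: S_def)
        then obtain x y where "e = {x,y}" using EV[OF e(1)] by (auto simp: card_2_iff)
        then show "e \<in> (\<lambda>w. {v,w}) ` N" using e by (auto simp: N_def insert_commute)
      qed
    qed (auto simp: S_def N_def)
    have cardS: "card S = card N" unfolding S
      by (rule card_image) (auto simp: inj_on_def doubleton_eq_iff)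
    have a1: "a \<ge> 1" using v \<open>q \<ge> 1\<close> by (simp add: a_def S_def Suc_le_eq div_greater_zero_iff)
    have qa: "q * a \<le> card S" by (simp add: a_def)
    have cS: "card S < q * a + q" using \<open>q \<ge> 1\<close>
      by (metis a_def mult_div_mod_eq mod_less_divisor nat_add_left_cancel_less less_le_trans zero_less_one)
    have "card W \<le> card N" using finN by (simp add: W_def card_mono)
    \<comment> \<open>The degree is at most q * a + q - 1, which falls short of a * (2 * q - 1) by
      (a - 1) * (q - 1).\<close>
    also have "\<dots> \<le> a * (2 * q - 1)"
    proof -
      obtain a' q' where [simp]: "a = Suc a'" "q = Suc q'"
        using a1 \<open>q \<ge> 1\<close> by (metis Suc_le_D One_nat_def)
      show ?thesis using cS cardS by (simp add: algebra_simps)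
    qed
    finally obtain Xs where Xs: "length Xs = a"
      "\<forall>X\<in>set Xs. X \<subseteq> insert v W \<and> card X \<le> Suc (2 * q - 1)"
      "\<forall>w\<in>N. odd (flip_count Xs {v,w}) \<longleftrightarrow> w \<in> W"
      using star_flips[of W v N a "2 * q - 1"] finN \<open>v \<notin> N\<close> by (auto simp: W_def)
    define E' where "E' = E - S"
    \<comment> \<open>The target is corrected for the side effects of the star inversions on edges
      away from \<open>v\<close>.\<close>
    define F' where "F' = {e. (e \<in> F) \<noteq> odd (flip_count Xs e)}"
    have cE': "card E' + card S = card E"
      unfolding E'_def using finE by (simp add: S_def card_Diff_subset card_mono)
    have aM: "a \<le> M"
    proof -
      have "q * a \<le> q * M" using qa cE' less.prems(5) by linarith
      then show ?thesis using \<open>q \<ge> 1\<close> by simp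
    qed
    have "\<exists>Ys. length Ys = (M - a) + k * (q - 1) \<and>
              (\<forall>X\<in>set Ys. X \<subseteq> V - {v} \<and> card X \<le> 2 * q) \<and>
              (\<forall>e\<in>E'. odd (flip_count Ys e) \<longleftrightarrow> e \<in> F')"
    proof (rule less.hyps)
      show "card E' < card E" using cE' v \<open>q \<ge> 1\<close> by (simp add: S_def)
      show "simple_graph (V - {v}) E'"
        using less.prems(1) by (auto simp: simple_graph_def E'_def S_def)
      show "inj_on r (V - {v})" using less.prems(2) by (rule inj_on_subset) auto
      show "card {u. {u,x} \<in> E' \<and> r u < r x} \<le> k" if "x \<in> V - {v}" for x
      proof -
        have "card {u. {u,x} \<in> E' \<and> r u < r x} \<le> card {u. {u,x} \<in> E \<and> r u < r x}"
          using EV finV by (intro card_mono) (auto simp: E'_def intro!: finite_subset[of _ V])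
        then show ?thesis using left[of x] that by simp
      qed
      \<comment> \<open>At least q * a edges have disappeared, which pays for the a
        inversions.\<close>
      show "card E' \<le> q * (M - a)" using cE' qa less.prems(5) by (simp add: diff_mult_distrib2)
    qed fact+
    then obtain Ys where Ys: "length Ys = (M - a) + k * (q - 1)"
      "\<forall>X\<in>set Ys. X \<subseteq> V - {v} \<and> card X \<le> 2 * q"
      "\<forall>e\<in>E'. odd (flip_count Ys e) \<longleftrightarrow> e \<in> F'" by blast
    have "odd (flip_count (Xs @ Ys) e) \<longleftrightarrow> e \<in> F" if e: "e \<in> E" for e
    proof (cases "e \<in> S")
      case True
      then obtain w where w: "e = {v,w}" "w \<in> N" using S by auto
      have "flip_count Ys e = 0" using Ys(2) w by (auto simp: flip_count_def filter_empty_conv)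
      then show ?thesis using Xs(3) w by (simp add: flip_count_append W_def)
    next
      case False
      then have "odd (flip_count Ys e) \<longleftrightarrow> e \<in> F'" using Ys(3) e by (simp add: E'_def)
      then show ?thesis by (auto simp: flip_count_append F'_def)
    qed
    moreover have "X \<subseteq> V \<and> card X \<le> 2 * q" if "X \<in> set (Xs @ Ys)" for X
    proof (cases "X \<in> set Xs")
      case True
      have "insert v W \<subseteq> V" using v \<open>N \<subseteq> V\<close> by (auto simp: W_def)
      then show ?thesis using True Xs(2) \<open>q \<ge> 1\<close> by fastforce
    next
      case False
      then show ?thesis using that Ys(2) by auto
    qed
    moreover have "length (Xs @ Ys) = M + k * (q - 1)" using Xs Ys aM by simp
    ultimately show ?thesis by blast
  qed
qed

section \<open>Euler's bound for plane drawings\<close>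

locale plane_drawing =
  fixes V :: "'a set" and E :: "'a set set" and f :: "'a \<Rightarrow> complex"
    and \<Gamma> :: "'a set \<Rightarrow> real \<Rightarrow> complex"
  assumes finV: "finite V"
    and EV: "e \<in> E \<Longrightarrow> e \<subseteq> V \<and> card e = 2"
    and inj_f: "inj_on f V"
    and arc_edge: "e \<in> E \<Longrightarrow> arc (\<Gamma> e)"
    and ends: "e \<in> E \<Longrightarrow> {pathstart (\<Gamma> e), pathfinish (\<Gamma> e)} = f ` e"
    and vertex_on_edge: "e \<in> E \<Longrightarrow> v \<in> V \<Longrightarrow> f v \<in> path_image (\<Gamma> e) \<Longrightarrow> v \<in> e"
    and edges_meet: "e \<in> E \<Longrightarrow> e' \<in> E \<Longrightarrow> e \<noteq> e' \<Longrightarrow>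
           path_image (\<Gamma> e) \<inter> path_image (\<Gamma> e') \<subseteq> f ` (e \<inter> e')"
begin

section \<open>Skeletons of plane drawings and the cycles closed by an edge\<close>

text \<open>All vertices are kept for every \<open>H\<close>, so that an edge outside
  \<open>H\<close> meets the skeleton in exactly its two ends.\<close>

definition skeleton :: "'a set set \<Rightarrow> complex set" where
  "skeleton H = f ` V \<union> (\<Union>e\<in>H. path_image (\<Gamma> e))"

definition open_arc :: "'a set \<Rightarrow> complex set" where
  "open_arc e = path_image (\<Gamma> e) - f ` e"

text \<open>A single boundary point on the open arc suffices, because the arc is connected and
  avoids the skeleton of the other edges.\<close>

definition borders :: "'a set \<Rightarrow> complex set \<Rightarrow> bool" where
  "borders e F \<longleftrightarrow> closure F \<inter> open_arc e \<noteq> {}"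

lemma finE: "finite E"
  using finV EV finite_subset[of E "Pow V"] by auto

lemma finite_edge: "e \<in> E \<Longrightarrow> finite e"
  using EV finV finite_subset by blast

lemma compact_skeleton: "H \<subseteq> E \<Longrightarrow> compact (skeleton H)"
  unfolding skeleton_def
proof (intro compact_Un compact_UN)
  show "compact (f ` V)" using finV by (simp add: finite_imp_compact)
qed (use finE arc_edge in \<open>auto intro: finite_subset compact_arc_image\<close>)

lemma skeleton_mono: "H \<subseteq> H' \<Longrightarrow> skeleton H \<subseteq> skeleton H'"
  by (auto simp: skeleton_def)

lemma skeleton_insert: "skeleton (insert e H) = path_image (\<Gamma> e) \<union> skeleton H"
  by (auto simp: skeleton_def)

lemma ends_subset: "e \<in> E \<Longrightarrow> f ` e \<subseteq> path_image (\<Gamma> e) \<inter> skeleton H"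
proof -
  assume e: "e \<in> E"
  have "{pathstart (\<Gamma> e), pathfinish (\<Gamma> e)} \<subseteq> path_image (\<Gamma> e)"
    by (simp add: pathstart_in_path_image pathfinish_in_path_image)
  then have "f ` e \<subseteq> path_image (\<Gamma> e)" using ends[OF e] by simp
  then show ?thesis using EV[OF e] by (auto simp: skeleton_def)
qed

lemma arc_Int_skeleton:
  assumes "e \<in> E" "H \<subseteq> E" "e \<notin> H"
  shows "path_image (\<Gamma> e) \<inter> skeleton H = f ` e"
proof
  show "path_image (\<Gamma> e) \<inter> skeleton H \<subseteq> f ` e"
  proof
    fix x assume x: "x \<in> path_image (\<Gamma> e) \<inter> skeleton H"
    then consider v where "v \<in> V" "x = f v" | e' where "e' \<in> H" "x \<in> path_image (\<Gamma> e')"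
      by (auto simp: skeleton_def)
    then show "x \<in> f ` e"
    proof cases
      case 1
      then show ?thesis using x vertex_on_edge assms by auto
    next
      case 2
      then have "x \<in> f ` (e \<inter> e')" using edges_meet[of e e'] x assms by blast
      then show ?thesis by blast
    qed
  qed
qed (use ends_subset assms in blast)

lemma open_arc_disjoint:
  assumes "e \<in> E" "H \<subseteq> E" "e \<notin> H"
  shows "open_arc e \<inter> skeleton H = {}"
  using arc_Int_skeleton[OF assms] by (auto simp: open_arc_def)

lemma open_arc: assumes "e \<in> E" shows "connected (open_arc e)" "open_arc e \<noteq> {}"
  using connected_simple_path_endless[of "\<Gamma> e"] nonempty_simple_path_endless[of "\<Gamma> e"]
    arc_imp_simple_path[OF arc_edge[OF assms]] ends[OF assms]
  by (auto simp: open_arc_def)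

text \<open>Any path in the skeleton that joins the ends of a further edge contains an arc, which that
  edge closes to a Jordan curve; so no combinatorial paths and cycles are needed.\<close>

lemma edge_closing_cycle:
  assumes e: "{u,v} \<in> E" "H \<subseteq> E" "{u,v} \<notin> H"
    and conn: "path_component (skeleton H) (f u) (f v)"
  obtains C I J where "C \<subseteq> skeleton (insert {u,v} H)" "path_image (\<Gamma> {u,v}) \<subseteq> C"
    "compact C" "connected (C \<inter> skeleton H)" "connected I" "connected J" "I \<inter> J = {}"
    "I \<union> J = - C" "frontier I = C" "frontier J = C"
proof -
  let ?e = "{u,v}"
  have uv: "u \<noteq> v" "u \<in> V" "v \<in> V" using EV[OF e(1)] by auto
  then have fuv: "f u \<noteq> f v" using inj_f by (auto dest: inj_onD)
  obtain p where p: "path p" "path_image p \<subseteq> skeleton H" "pathstart p = f u" "pathfinish p = f v"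
    using conn by (auto simp: path_component_def)
  obtain q where q: "arc q" "path_image q \<subseteq> path_image p" "pathstart q = f u" "pathfinish q = f v"
    using path_contains_arc[OF p(1,3,4) fuv] by blast
  \<comment> \<open>The arc is reversed if necessary, so that it leads back from the end of
    \<open>q\<close> to its start.\<close>
  obtain g where g: "arc g" "path_image g = path_image (\<Gamma> ?e)" "pathstart g = f v" "pathfinish g = f u"
  proof (cases "pathstart (\<Gamma> ?e) = f v")
    case True
    then have "pathfinish (\<Gamma> ?e) = f u" using ends[OF e(1)] fuv by (auto simp: doubleton_eq_iff)
    then show ?thesis using that[of "\<Gamma> ?e"] True arc_edge e by auto
  next
    case False
    then have "pathstart (\<Gamma> ?e) = f u" "pathfinish (\<Gamma> ?e) = f v"
      using ends[OF e(1)] fuv by (auto simp: doubleton_eq_iff)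
    then show ?thesis using that[of "reversepath (\<Gamma> ?e)"] arc_edge[OF e(1)]
      by (auto simp: arc_reversepath)
  qed
  have int: "path_image (\<Gamma> ?e) \<inter> skeleton H = {f u, f v}" using arc_Int_skeleton[OF e] by simp
  have sp: "simple_path (q +++ g)"
    using int q p g by (intro simple_path_join_loop) auto
  define C where "C = path_image (q +++ g)"
  have C: "C = path_image q \<union> path_image (\<Gamma> ?e)"
    using g q by (simp add: C_def path_image_join)
  have J: "connected (inside C)" "connected (outside C)" "inside C \<inter> outside C = {}"
    "inside C \<union> outside C = - C" "frontier (inside C) = C" "frontier (outside C) = C"
    using Jordan_inside_outside[OF sp] q g by (auto simp: C_def)
  have "{f u, f v} \<subseteq> path_image q"
    using q(3,4) pathstart_in_path_image[of q] pathfinish_in_path_image[of q] by simp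
  \<comment> \<open>The intersection is an arc; its connectedness is what Janiszewski's theorem
    needs for the union of \<open>C\<close> and \<open>skeleton H\<close>.\<close>
  then have "C \<inter> skeleton H = path_image q"
    using int q(2) p(2) unfolding C by blast
  then have "connected (C \<inter> skeleton H)" using q by (simp add: connected_arc_image)
  moreover have "compact C" using sp by (simp add: C_def compact_simple_path_image)
  moreover have "C \<subseteq> skeleton (insert ?e H)" using q p by (auto simp: C skeleton_insert)
  moreover have "path_image (\<Gamma> ?e) \<subseteq> C" by (auto simp: C)
  ultimately show thesis using J that by blast
qed

text \<open>Every edge is path-connected, hence lies inside the component or misses it. Both sets
  are thus finite unions of points and arcs.\<close>

lemma closed_path_component_skeleton:
  fixes x :: complex
  assumes "H \<subseteq> E"
  defines "A \<equiv> path_component_set (skeleton H) x"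
  shows "closed A" "closed (skeleton H - A)"
proof -
  have pc: "path_image (\<Gamma> e) \<subseteq> A" if "e \<in> H" "path_image (\<Gamma> e) \<inter> A \<noteq> {}" for e
  proof -
    obtain y where y: "y \<in> path_image (\<Gamma> e)" "path_component (skeleton H) x y"
      using \<open>path_image (\<Gamma> e) \<inter> A \<noteq> {}\<close> by (auto simp: A_def)
    have "path_connected (path_image (\<Gamma> e))" "path_image (\<Gamma> e) \<subseteq> skeleton H"
      using that assms arc_edge by (auto simp: path_connected_path_image arc_imp_path skeleton_def)
    then have "path_component (skeleton H) y z" if "z \<in> path_image (\<Gamma> e)" for z
      using y that by (meson path_component_of_subset path_connected_component)
    then show ?thesis using y by (auto simp: A_def intro: path_component_trans)
  qed
  have A: "A \<subseteq> skeleton H" by (auto simp: A_def path_component_mem)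
  have cl: "closed (f ` W \<union> (\<Union>e\<in>K. path_image (\<Gamma> e)))" if "W \<subseteq> V" "K \<subseteq> H" for W K
  proof -
    have "closed (f ` W)" using that finV by (auto intro: finite_imp_closed finite_subset)
    moreover have "finite K" using that assms(1) finE by (auto intro: finite_subset)
    moreover have "closed (path_image (\<Gamma> e))" if "e \<in> K" for e
      using arc_edge[of e] that \<open>K \<subseteq> H\<close> assms(1) by (auto intro: closed_arc_image)
    ultimately show ?thesis by (intro closed_Un closed_UN) auto
  qed
  have "A = f ` {w\<in>V. f w \<in> A} \<union> (\<Union>e\<in>{e\<in>H. path_image (\<Gamma> e) \<inter> A \<noteq> {}}. path_image (\<Gamma> e))"
    (is "_ = ?B")
  proof
    show "A \<subseteq> ?B" using A unfolding skeleton_def by blast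
    show "?B \<subseteq> A" using pc by blast
  qed
  moreover have "closed ?B" by (rule cl) auto
  ultimately show "closed A" by simp
  have "skeleton H - A = f ` {w\<in>V. f w \<notin> A} \<union> (\<Union>e\<in>{e\<in>H. path_image (\<Gamma> e) \<inter> A = {}}. path_image (\<Gamma> e))"
    (is "_ = ?D")
  proof
    show "skeleton H - A \<subseteq> ?D"
    proof
      fix z assume z: "z \<in> skeleton H - A"
      then consider "z \<in> f ` V" | e where "e \<in> H" "z \<in> path_image (\<Gamma> e)"
        by (auto simp: skeleton_def)
      then show "z \<in> ?D"
      proof cases
        case 1
        then show ?thesis using z by auto
      next
        case 2
        then have "path_image (\<Gamma> e) \<inter> A = {}" using z pc by blast
        then show ?thesis using 2 by blast
      qed
    qed
    show "?D \<subseteq> skeleton H - A" by (auto simp: skeleton_def)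
  qed
  moreover have "closed ?D" by (rule cl) auto
  ultimately show "closed (skeleton H - A)" by simp
qed

section \<open>An edge borders at most two faces\<close>

text \<open>Gluing the open arc to \<open>F\<close> at a common boundary point keeps it connected.
  Hence all faces bordering \<open>e\<close> fall into one face once \<open>e\<close> is
  deleted.\<close>

lemma bordering_face_reaches_arc:
  assumes "e \<in> E" "F \<in> components (- skeleton E)" "borders e F" "a \<in> F" "z \<in> open_arc e"
  shows "connected_component (- skeleton (E - {e})) a z"
proof -
  obtain x where x: "x \<in> closure F" "x \<in> open_arc e" using assms by (auto simp: borders_def)
  have "connected F" "F \<subseteq> - skeleton E"
    using assms in_components_connected in_components_subset by blast+
  have "connected (insert x F)"
    using x closure_subset[of F]
    by (intro connected_intermediate_closure[OF \<open>connected F\<close>]) auto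
  then have "connected (insert x F \<union> open_arc e)"
    using x open_arc[OF assms(1)] by (intro connected_Un) auto
  moreover have "insert x F \<union> open_arc e \<subseteq> - skeleton (E - {e})"
    using x \<open>F \<subseteq> - skeleton E\<close> open_arc_disjoint[of e "E - {e}"] assms(1) skeleton_mono[of "E - {e}" E]
    by blast
  ultimately show ?thesis using assms(4,5) unfolding connected_component_def by blast
qed

lemma components_eqI:
  assumes "F \<in> components S" "F' \<in> components S" "a \<in> F" "b \<in> F'" "connected_component S a b"
  shows "F = F'"
  using assms by (metis components_iff connected_component_eq mem_Collect_eq)

text \<open>Let \<open>A\<close> be the component of \<open>f u\<close> without the edge
  \<open>P\<close>. Then \<open>P\<close> meets \<open>A\<close> only in \<open>f u\<close>, and
  \<open>P \<union> A\<close> meets the rest of the skeleton only in \<open>f v\<close>. An arc does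
  not separate the plane, so two applications of Janiszewski's theorem give the claim.\<close>

lemma bridge_one_face:
  assumes e: "{u,v} \<in> E" and nc: "\<not> path_component (skeleton (E - {{u,v}})) (f u) (f v)"
    and ab: "connected_component (- skeleton (E - {{u,v}})) a b" "a \<notin> skeleton E" "b \<notin> skeleton E"
  shows "connected_component (- skeleton E) a b"
proof -
  let ?e = "{u,v}"
  let ?H = "E - {?e}"
  define A where "A = path_component_set (skeleton ?H) (f u)"
  define P where "P = path_image (\<Gamma> ?e)"
  have uv: "u \<in> V" "v \<in> V" using EV[OF e] by auto
  have A: "A \<subseteq> skeleton ?H" by (auto simp: A_def path_component_mem)
  have int: "P \<inter> skeleton ?H = {f u, f v}" using arc_Int_skeleton[OF e, of ?H] by (auto simp: P_def)
  have fu: "f u \<in> A" using int by (auto simp: A_def intro: path_component_refl)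
  have fv: "f v \<notin> A" using nc by (simp add: A_def)
  have clA: "closed A" "closed (skeleton ?H - A)"
    unfolding A_def by (intro closed_path_component_skeleton Diff_subset)+
  have arcP: "arc (\<Gamma> ?e)" using arc_edge e by simp
  have sk: "skeleton E = (P \<union> A) \<union> (skeleton ?H - A)"
    using skeleton_insert[of ?e ?H] e A by (auto simp: insert_absorb P_def)
  have coP: "connected (- P)" using connected_arc_complement[OF arcP] by (simp add: P_def)
  have cmpP: "compact P" using arcP by (simp add: P_def compact_arc_image)
  have cmpA: "compact A"
    using compact_skeleton[of ?H] A clA by (metis Diff_subset closed_Int_compact inf.absorb_iff1)
  have "a \<in> - P" "b \<in> - P" using ab sk by auto
  then have "connected_component (- P) a b"
    using coP by (simp add: connected_iff_connected_component)
  moreover have "connected_component (- A) a b"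
    using A ab(1) connected_component_of_subset by (metis Compl_subset_Compl_iff)
  moreover have "P \<inter> A = {f u}" using int A fu fv by auto
  ultimately have 1: "connected_component (- (P \<union> A)) a b"
    using cmpP clA by (intro Janiszewski) auto
  have 2: "connected_component (- (skeleton ?H - A)) a b"
    by (rule connected_component_of_subset[OF ab(1)]) auto
  have "(P \<union> A) \<inter> (skeleton ?H - A) = P \<inter> skeleton ?H - A" by auto
  also have "\<dots> = {f v}" using int fu fv by (simp add: insert_Diff_if)
  finally have "(P \<union> A) \<inter> (skeleton ?H - A) = {f v}" .
  then have "connected ((P \<union> A) \<inter> (skeleton ?H - A))" by simp
  then show ?thesis
    unfolding sk by (rule Janiszewski[OF compact_Un[OF cmpP cmpA] clA(2) _ 1 2])
qed

text \<open>A bridge borders at most one face. Any other edge lies on a Jordan curve, and each side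
  of the curve meets at most one bordering face. The form as an inclusion also yields
  finiteness.\<close>

lemma edge_borders_two_faces:
  assumes "e \<in> E"
  shows "\<exists>F1 F2. {F \<in> components (- skeleton E). borders e F} \<subseteq> {F1, F2}"
proof -
  let ?A = "{F \<in> components (- skeleton E). borders e F}"
  let ?H = "E - {e}"
  obtain u v where uv: "e = {u,v}" using EV[OF assms] by (auto simp: card_2_iff)
  have ins: "insert e ?H = E" using assms by auto
  obtain z where z: "z \<in> open_arc e" using open_arc(2)[OF assms] by auto
  have conn: "connected_component (- skeleton ?H) a b" if "F \<in> ?A" "F' \<in> ?A" "a \<in> F" "b \<in> F'" for F F' a b
  proof -
    have "connected_component (- skeleton ?H) a z" "connected_component (- skeleton ?H) b z"
      using bordering_face_reaches_arc[OF assms _ _ _ z] that by auto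
    then show ?thesis by (blast intro: connected_component_sym connected_component_trans)
  qed
  have sub: "F \<subseteq> - skeleton E" "F \<noteq> {}" "connected F" if "F \<in> ?A" for F
    using that in_components_subset in_components_nonempty in_components_connected by blast+
  have one: "\<exists>F0. B \<subseteq> {F0}" if "\<forall>F\<in>B. \<forall>F'\<in>B. F = F'" for B :: "complex set set"
  proof (cases "B = {}")
    case False
    then obtain F0 where "F0 \<in> B" by blast
    then show ?thesis using that by (intro exI[of _ F0]) auto
  qed auto
  show ?thesis
  proof (cases "path_component (skeleton ?H) (f u) (f v)")
    case False
    have "F = F'" if F: "F \<in> ?A" "F' \<in> ?A" for F F'
    proof -
      obtain a b where ab: "a \<in> F" "b \<in> F'" using sub(2)[OF F(1)] sub(2)[OF F(2)] by auto
      have "connected_component (- skeleton E) a b"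
        using bridge_one_face[of u v a b] False assms conn[OF F ab] sub(1)[OF F(1)] sub(1)[OF F(2)] ab
        by (auto simp: uv)
      then show ?thesis using F ab by (intro components_eqI[of F _ F' a b]) auto
    qed
    then have "\<forall>F\<in>?A. \<forall>F'\<in>?A. F = F'" by simp
    from one[OF this] obtain F0 where "?A \<subseteq> {F0}" by (elim exE)
    then have "?A \<subseteq> {F0, F0}" by simp
    then show ?thesis by (intro exI)
  next
    case True
    obtain C I J where C: "C \<subseteq> skeleton E" "path_image (\<Gamma> e) \<subseteq> C"
      "compact C" "connected (C \<inter> skeleton ?H)" "connected I" "connected J" "I \<inter> J = {}"
      "I \<union> J = - C" "frontier I = C" "frontier J = C"
      using edge_closing_cycle[of u v ?H] assms True ins unfolding uv by auto
    have sk: "skeleton E = C \<union> skeleton ?H"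
      using C(1,2) skeleton_insert[of e ?H] skeleton_mono[of ?H E] unfolding ins by blast
    \<comment> \<open>Points of the two faces are joined inside \<open>K\<close> off
      \<open>C\<close>, and off \<open>skeleton ?H\<close> by \<open>conn\<close>; since
      \<open>C \<inter> skeleton ?H\<close> is connected, the union does not separate them
      either.\<close>
    have "F = F'" if F: "F \<in> ?A" "F' \<in> ?A" and K: "connected K" "K \<subseteq> - C" "F \<inter> K \<noteq> {}" "F' \<inter> K \<noteq> {}"
      for F F' K
    proof -
      obtain a b where ab: "a \<in> F" "b \<in> F'" "a \<in> K" "b \<in> K" using K by blast
      have "connected_component (- C) a b"
        using K ab unfolding connected_component_def by blast
      then have "connected_component (- skeleton E) a b"
        unfolding sk using C conn[OF F ab(1,2)] compact_skeleton[of ?H]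
        by (intro Janiszewski compact_imp_closed) auto
      then show ?thesis using F ab by (intro components_eqI[of F _ F' a b]) auto
    qed
    then have "F = F'" if "F \<in> ?A" "F' \<in> ?A" "K = I \<or> K = J" "F \<inter> K \<noteq> {}" "F' \<inter> K \<noteq> {}" for F F' K
      using that C(5,6,8) by blast
    then have "\<exists>F0. {F\<in>?A. F \<inter> K \<noteq> {}} \<subseteq> {F0}" if "K = I \<or> K = J" for K
      by (intro one) (use that in auto)
    from this[of I] this[of J] obtain F1 F2 where "{F\<in>?A. F \<inter> I \<noteq> {}} \<subseteq> {F1}" "{F\<in>?A. F \<inter> J \<noteq> {}} \<subseteq> {F2}"
      by auto
    moreover have "?A \<subseteq> {F\<in>?A. F \<inter> I \<noteq> {}} \<union> {F\<in>?A. F \<inter> J \<noteq> {}}"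
    proof
      fix F assume F: "F \<in> ?A"
      then have "F \<inter> I \<noteq> {} \<or> F \<inter> J \<noteq> {}" using sub(1,2)[OF F] C(1,8) by blast
      then show "F \<in> {F\<in>?A. F \<inter> I \<noteq> {}} \<union> {F\<in>?A. F \<inter> J \<noteq> {}}" using F by simp
    qed
    ultimately have "?A \<subseteq> {F1} \<union> {F2}" by (meson Un_mono order_trans)
    then have "?A \<subseteq> {F1, F2}" unfolding insert_is_Un[of F1 "{F2}"] .
    then show ?thesis by (intro exI)
  qed
qed

section \<open>A face borders at least three edges\<close>

text \<open>Two distinct edges share at most one point, so Janiszewski's theorem applies to the two
  arcs. Deleting the finitely many vertices keeps an open connected plane set connected.\<close>

lemma connected_complement_two_edges:
  assumes "Q \<subseteq> E" "card Q \<le> 2"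
  shows "connected (- skeleton Q)"
proof -
  have finQ: "finite Q" using assms finE finite_subset by blast
  let ?U = "\<Union>e\<in>Q. path_image (\<Gamma> e)"
  have co: "connected (- path_image (\<Gamma> e))" if "e \<in> E" for e
    using connected_arc_complement[OF arc_edge[OF that]] by simp
  have cm: "compact (path_image (\<Gamma> e))" if "e \<in> E" for e
    using arc_edge[OF that] by (simp add: compact_arc_image)
  consider "Q = {}" | e where "Q = {e}" | e e' where "Q = {e,e'}" "e \<noteq> e'"
  proof -
    have "card Q = 0 \<or> card Q = 1 \<or> card Q = 2" using assms by linarith
    then show ?thesis using finQ that by (auto simp: card_1_singleton_iff card_2_iff)
  qed
  then have "connected (- ?U)"
  proof cases
    case 3
    have "card (e \<inter> e') \<le> 1"
    proof (rule ccontr)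
      assume "\<not> card (e \<inter> e') \<le> 1"
      then have "2 \<le> card (e \<inter> e')" by simp
      moreover have "finite e" "finite e'" "card e = 2" "card e' = 2"
        using 3 assms EV finite_edge by simp_all
      ultimately have "e \<inter> e' = e" "e \<inter> e' = e'"
        by (metis card_seteq inf_le1, metis card_seteq inf_le2)
      then show False using 3 by auto
    qed
    moreover have "finite e" using 3 assms finite_edge by simp
    ultimately have "\<exists>x. e \<inter> e' \<subseteq> {x}"
      by (metis card_le_Suc0_iff_eq finite_Int One_nat_def singletonI subsetI all_not_in_conv)
    then obtain x where x: "e \<inter> e' \<subseteq> {x}" by (elim exE)
    have "path_image (\<Gamma> e) \<inter> path_image (\<Gamma> e') \<subseteq> f ` (e \<inter> e')"
      using edges_meet[of e e'] 3 assms by simp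
    also have "\<dots> \<subseteq> {f x}" using x by auto
    finally have "connected (path_image (\<Gamma> e) \<inter> path_image (\<Gamma> e'))"
      by (metis connected_empty connected_sing subset_singletonD)
    then have "connected (- (path_image (\<Gamma> e) \<union> path_image (\<Gamma> e')))"
      using 3 assms co cm by (intro Janiszewski_connected compact_imp_closed) auto
    then show ?thesis using 3 by simp
  qed (use co assms in auto)
  moreover have "open (- ?U)"
    using finQ assms cm by (intro open_Compl closed_UN) (auto intro: compact_imp_closed)
  ultimately have "connected (- ?U - f ` V)"
    using finV by (intro connected_open_delete_finite) auto
  moreover have "- ?U - f ` V = - skeleton Q" by (auto simp: skeleton_def)
  ultimately show ?thesis by simp
qed

text \<open>Otherwise the frontier of \<open>F\<close> lies in the skeleton of at most two edges.
  The complement of that skeleton is connected and contains \<open>F\<close> as well as a point of a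
  third edge, so it would have to meet the frontier.\<close>

lemma face_borders_three_edges:
  assumes "card E \<ge> 3" and F: "F \<in> components (- skeleton E)"
  shows "card {e\<in>E. borders e F} \<ge> 3"
proof (rule ccontr)
  define Q where "Q = {e\<in>E. borders e F}"
  assume "\<not> card {e\<in>E. borders e F} \<ge> 3"
  then have Q: "Q \<subseteq> E" "card Q \<le> 2" by (auto simp: Q_def)
  have FE: "F \<subseteq> - skeleton E" "F \<noteq> {}"
    using F in_components_subset in_components_nonempty by blast+
  have op: "open (- skeleton E)" using compact_skeleton by (simp add: compact_imp_closed open_Compl)
  have "open F" using F op by (simp add: open_components)
  have fr: "frontier F \<subseteq> skeleton Q"
  proof
    fix x assume x: "x \<in> frontier F"
    then have xc: "x \<in> closure F" "x \<notin> F"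
      using \<open>open F\<close> by (auto simp: frontier_def interior_open)
    \<comment> \<open>A frontier point off the skeleton could be added to \<open>F\<close>, against
      the maximality of components.\<close>
    have "x \<in> skeleton E"
    proof (rule ccontr)
      assume n: "x \<notin> skeleton E"
      have "connected (insert x F)"
        using xc closure_subset[of F]
        by (intro connected_intermediate_closure[OF in_components_connected[OF F]]) auto
      then have "insert x F \<subseteq> F"
        using n FE by (intro components_maximal[OF F]) auto
      then show False using xc by auto
    qed
    then consider "x \<in> f ` V" | e where "e \<in> E" "x \<in> path_image (\<Gamma> e)"
      by (auto simp: skeleton_def)
    then show "x \<in> skeleton Q"
    proof cases
      case 1
      then show ?thesis by (simp add: skeleton_def)
    next
      case 2
      show ?thesis
      proof (cases "x \<in> f ` e")
        case True
        then show ?thesis using ends_subset 2 by blast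
      next
        case False
        then have "e \<in> Q" using 2 xc by (auto simp: Q_def borders_def open_arc_def)
        then show ?thesis using 2 by (auto simp: skeleton_def)
      qed
    qed
  qed
  have "E \<noteq> Q" using Q assms(1) by auto
  then obtain e where e: "e \<in> E" "e \<notin> Q" using Q by auto
  obtain z where z: "z \<in> open_arc e" using open_arc(2)[OF e(1)] by auto
  have "z \<notin> skeleton Q" using open_arc_disjoint[of e Q] e Q z by blast
  moreover have "z \<notin> F" using z FE e by (auto simp: open_arc_def skeleton_def)
  ultimately have "- skeleton Q - F \<noteq> {}" by auto
  moreover have "- skeleton Q \<inter> F \<noteq> {}" using FE skeleton_mono[OF Q(1)] by blast
  ultimately have "- skeleton Q \<inter> frontier F \<noteq> {}"
    using connected_Int_frontier connected_complement_two_edges[OF Q] by blast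
  then show False using fr by blast
qed

section \<open>Counting faces and Euler's bound\<close>

text \<open>The points of \<open>Z\<close> stand for distinct faces; counting points instead of faces avoids proving first
  that there are finitely many faces.\<close>

lemma separated_points:
  assumes "finite R" "R \<subseteq> E" "T \<subseteq> E" "R \<inter> T = {}"
    and "\<And>u v. {u,v} \<in> R \<Longrightarrow> path_component (skeleton T) (f u) (f v)"
  shows "\<exists>Z. finite Z \<and> card Z \<ge> Suc (card R) \<and> Z \<inter> skeleton (T \<union> R) = {} \<and>
    (\<forall>a\<in>Z. \<forall>b\<in>Z. a \<noteq> b \<longrightarrow> \<not> connected_component (- skeleton (T \<union> R)) a b)"
  using assms
proof (induction R rule: finite_induct)
  case empty
  have "skeleton T \<noteq> UNIV" using compact_skeleton[of T] assms(3) not_compact_UNIV by metis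
  then obtain z where "z \<notin> skeleton T" by auto
  then show ?case by (intro exI[of _ "{z}"]) auto
next
  case (insert e R)
  let ?H = "T \<union> R"
  have H: "?H \<subseteq> E" "e \<in> E" "e \<notin> ?H" using insert by auto
  obtain Z where Z: "finite Z" "card Z \<ge> Suc (card R)" "Z \<inter> skeleton ?H = {}"
    "\<forall>a\<in>Z. \<forall>b\<in>Z. a \<noteq> b \<longrightarrow> \<not> connected_component (- skeleton ?H) a b"
    using insert.IH insert.prems by auto
  obtain u v where uv: "e = {u,v}" using EV[OF H(2)] by (auto simp: card_2_iff)
  have "path_component (skeleton ?H) (f u) (f v)"
    using insert.prems(4)[of u v] uv skeleton_mono[of T ?H] path_component_of_subset by blast
  then obtain C I J where C: "C \<subseteq> skeleton (insert e ?H)" "path_image (\<Gamma> e) \<subseteq> C"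
    "connected I" "connected J" "I \<inter> J = {}" "I \<union> J = - C" "frontier I = C" "frontier J = C"
    using edge_closing_cycle[of u v ?H] H unfolding uv by metis
  obtain z where z: "z \<in> open_arc e" using open_arc(2)[OF H(2)] by auto
  have zH: "z \<notin> skeleton ?H" using open_arc_disjoint[of e ?H] H z by blast
  have op: "open (- skeleton ?H)" using compact_skeleton[OF H(1)] by (simp add: compact_imp_closed open_Compl)
  obtain d where d: "d > 0" "ball z d \<subseteq> - skeleton ?H"
    using op zH by (metis ComplI openE)
  have "z \<in> C" using z C(2) by (auto simp: open_arc_def)
  then have "z \<in> closure I" "z \<in> closure J" using C(7,8) by (auto simp: frontier_def)
  \<comment> \<open>One point on each side of the new cycle, so close to \<open>z\<close> that both
    lie in the old face crossed by the new edge.\<close>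
  then obtain a b where ab: "a \<in> I" "b \<in> J" "dist a z < d" "dist b z < d"
    using d(1) by (meson closure_approachable)
  have near: "connected_component (- skeleton ?H) z x" if "dist x z < d" for x
    using that d unfolding connected_component_def
    by (intro exI[of _ "ball z d"]) (auto simp: dist_commute)
  have ins: "T \<union> insert e R = insert e ?H" by auto
  have mono: "connected_component (- skeleton ?H) x y" if "connected_component (- skeleton (insert e ?H)) x y" for x y
    by (rule connected_component_of_subset[OF that]) (use skeleton_mono[of ?H "insert e ?H"] in blast)
  \<comment> \<open>Only the representative of the face crossed by the new edge is discarded, at
    most one point; \<open>a\<close> and \<open>b\<close> replace it, for a net gain of at least
    one.\<close>
  define Y where "Y = {y\<in>Z. \<not> connected_component (- skeleton ?H) y z}"
  have "card (Z - Y) \<le> 1"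
  proof -
    have "x = y" if "x \<in> Z - Y" "y \<in> Z - Y" for x y
      using that Z(4) connected_component_sym connected_component_trans unfolding Y_def
      by (metis (no_types, lifting) DiffE mem_Collect_eq)
    then show ?thesis using Z(1) by (metis One_nat_def card_le_Suc0_iff_eq finite_Diff)
  qed
  then have cY: "card Y \<ge> card R" using Z(1,2)
    by (auto simp: Y_def card_Diff_subset)
  have nab: "x \<notin> Y" if "x \<in> {a,b}" for x
    using that near ab connected_component_sym unfolding Y_def by blast
  have "a \<noteq> b" using ab C(5) by auto
  \<comment> \<open>A connected set from \<open>a\<close> to \<open>b\<close> would cross the
    frontier of \<open>I\<close>, which is the cycle \<open>C\<close> inside the new
    skeleton.\<close>
  have sep: "\<not> connected_component (- skeleton (insert e ?H)) a b"
  proof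
    assume "connected_component (- skeleton (insert e ?H)) a b"
    then have "connected_component (- C) a b"
      using connected_component_of_subset C(1) by (metis Compl_subset_Compl_iff)
    then obtain K where K: "connected K" "K \<subseteq> - C" "a \<in> K" "b \<in> K"
      by (auto simp: connected_component_def)
    have "b \<notin> I" using ab C(5) by auto
    then have "K \<inter> frontier I \<noteq> {}" using K ab by (intro connected_Int_frontier) auto
    then show False using K C(7) by auto
  qed
  have farY: "\<not> connected_component (- skeleton (insert e ?H)) y x"
    if "y \<in> Y" "x \<in> {a,b}" for x y
    using that mono near ab connected_component_sym connected_component_trans unfolding Y_def by blast
  have "Y \<inter> path_image (\<Gamma> e) = {}"
  proof (rule ccontr)
    assume "Y \<inter> path_image (\<Gamma> e) \<noteq> {}"
    then obtain y where y: "y \<in> Y" "y \<in> path_image (\<Gamma> e)" by auto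
    then have "y \<in> open_arc e"
      using Z(3) arc_Int_skeleton[of e ?H] H by (auto simp: Y_def open_arc_def)
    then have "connected_component (- skeleton ?H) y z"
      using z open_arc(1)[OF H(2)] open_arc_disjoint[of e ?H] H
      unfolding connected_component_def by blast
    then show False using y by (simp add: Y_def)
  qed
  then have Yd: "Y \<inter> skeleton (insert e ?H) = {}"
    using Z(3) by (auto simp: skeleton_insert Y_def)
  have abd: "{a,b} \<inter> skeleton (insert e ?H) = {}"
  proof -
    have "a \<notin> C" "b \<notin> C" using ab C(6) by auto
    moreover have "a \<notin> skeleton ?H" "b \<notin> skeleton ?H" using ab(3,4) d(2) by (auto simp: dist_commute mem_ball subset_iff)
    ultimately show ?thesis using C(2) by (auto simp: skeleton_insert)
  qed
  let ?Z = "insert a (insert b Y)"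
  have "\<not> connected_component (- skeleton (insert e ?H)) x y" if "x \<in> ?Z" "y \<in> ?Z" "x \<noteq> y" for x y
  proof -
    consider "x \<in> Y" "y \<in> Y" | "x \<in> Y" "y \<in> {a,b}" | "x \<in> {a,b}" "y \<in> Y" | "x \<in> {a,b}" "y \<in> {a,b}"
      using \<open>x \<in> ?Z\<close> \<open>y \<in> ?Z\<close> by blast
    then show ?thesis
    proof cases
      case 1
      then show ?thesis using Z(4) \<open>x \<noteq> y\<close> mono unfolding Y_def by blast
    next
      case 2
      then show ?thesis using farY by blast
    next
      case 3
      then show ?thesis using farY connected_component_sym by blast
    next
      case 4
      then show ?thesis using sep connected_component_sym \<open>x \<noteq> y\<close> by blast
    qed
  qed
  moreover have "finite Y" using Z by (simp add: Y_def)
  moreover from this have "card ?Z \<ge> Suc (card (insert e R))"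
    using cY nab \<open>a \<noteq> b\<close> insert.hyps by simp
  moreover have "?Z \<inter> skeleton (insert e ?H) = {}" using Yd abd by blast
  ultimately show ?case unfolding ins by (intro exI[of _ ?Z]) auto
qed

text \<open>\<open>T\<close> is a spanning forest, \<open>R\<close> a set of roots of its trees.\<close>

lemma spanning_forest:
  assumes "V \<noteq> {}" "finite S" "S \<subseteq> E"
  shows "\<exists>T\<subseteq>S. \<exists>R\<subseteq>V. R \<noteq> {} \<and> card T + card R \<le> card V \<and>
    (\<forall>v\<in>V. \<exists>x\<in>R. path_component (skeleton T) (f v) (f x)) \<and>
    (\<forall>u v. {u,v} \<in> S \<longrightarrow> path_component (skeleton T) (f u) (f v))"
  using assms(2,3)
proof (induction S rule: finite_induct)
  case empty
  \<comment> \<open>Without edges every vertex is its own root.\<close>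
  show ?case using assms(1)
    by (intro exI[of _ "{}"] conjI exI[of _ V])
       (auto simp: skeleton_def intro!: bexI path_component_refl)
next
  case (insert e S)
  obtain T R where TR: "T \<subseteq> S" "R \<subseteq> V" "R \<noteq> {}" "card T + card R \<le> card V"
    "\<forall>v\<in>V. \<exists>x\<in>R. path_component (skeleton T) (f v) (f x)"
    "\<forall>u v. {u,v} \<in> S \<longrightarrow> path_component (skeleton T) (f u) (f v)"
    using insert.IH insert.prems by auto
  have eE: "e \<in> E" using insert.prems by auto
  obtain u v where uv: "e = {u,v}" using EV[OF eE] by (auto simp: card_2_iff)
  then have uvV: "u \<in> V" "v \<in> V" using EV[OF eE] by auto
  show ?case
  proof (cases "path_component (skeleton T) (f u) (f v)")
    case True
    then have "\<forall>x y. {x,y} \<in> insert e S \<longrightarrow> path_component (skeleton T) (f x) (f y)"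
      using TR(6) uv path_component_sym by (auto simp: doubleton_eq_iff)
    then show ?thesis using TR by blast
  next
    case False
    obtain x y where xy: "x \<in> R" "y \<in> R" "path_component (skeleton T) (f u) (f x)"
      "path_component (skeleton T) (f v) (f y)" using TR(5) uvV by blast
    have "x \<noteq> y" using xy False path_component_sym path_component_trans by metis
    have up: "path_component (skeleton (insert e T)) a b" if "path_component (skeleton T) a b" for a b
      using path_component_of_subset[OF skeleton_mono that] by blast
    have "path_connected (path_image (\<Gamma> e))"
      using arc_edge[OF eE] by (simp add: path_connected_path_image arc_imp_path)
    then have "path_component (path_image (\<Gamma> e)) (f u) (f v)"
      using ends_subset[OF eE] uv by (auto simp: path_connected_component)
    then have puv: "path_component (skeleton (insert e T)) (f u) (f v)"
      by (rule path_component_of_subset[rotated]) (simp add: skeleton_insert)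
    then have yx: "path_component (skeleton (insert e T)) (f y) (f x)"
      using up xy by (meson path_component_sym path_component_trans)
    have "finite T" "finite R" using TR finV insert.hyps finite_subset by blast+
    \<comment> \<open>The new edge merges the trees of \<open>x\<close> and \<open>y\<close>; one
      edge is gained and the root \<open>y\<close> is given up, so the bound is preserved.\<close>
    then have "card (insert e T) + card (R - {y}) \<le> card V"
      using TR(4) xy card_insert_le_m1[of "Suc (card T)" T e] card_Suc_Diff1[of R y] by simp
    moreover have "\<exists>w\<in>R - {y}. path_component (skeleton (insert e T)) (f a) (f w)" if "a \<in> V" for a
    proof -
      obtain w where w: "w \<in> R" "path_component (skeleton T) (f a) (f w)" using TR(5) \<open>a \<in> V\<close> by auto
      show ?thesis
      proof (cases "w = y")
        case True
        then have "path_component (skeleton (insert e T)) (f a) (f x)"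
          using up w yx path_component_trans by blast
        then show ?thesis using xy \<open>x \<noteq> y\<close> by blast
      next
        case False
        then show ?thesis using up w by blast
      qed
    qed
    moreover have "\<forall>a b. {a,b} \<in> insert e S \<longrightarrow> path_component (skeleton (insert e T)) (f a) (f b)"
      using TR(6) uv puv up path_component_sym by (auto simp: doubleton_eq_iff)
    moreover have "insert e T \<subseteq> insert e S" "R - {y} \<subseteq> V" "R - {y} \<noteq> {}"
      using TR xy \<open>x \<noteq> y\<close> by auto
    ultimately show ?thesis by blast
  qed
qed

text \<open>At least |E| - |T| + 1 faces exist and |T| is at most |V| - 1, giving at least |E| - |V|
  + 2 faces. Counting incidences of edges and faces twice shows that three times the number of faces
  is at most 2|E|. Connectedness of the graph is not assumed, as only these inequalities
  enter.\<close>

theorem Euler_edge_bound: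
  assumes "card V \<ge> 3"
  shows "card E + 6 \<le> 3 * card V"
proof (cases "card E \<ge> 3")
  case False
  then show ?thesis using assms by simp
next
  case True
  let ?Fs = "components (- skeleton E)"
  have "V \<noteq> {}" using assms by auto
  then obtain T R where TR: "T \<subseteq> E" "R \<subseteq> V" "R \<noteq> {}" "card T + card R \<le> card V"
    "\<forall>u v. {u,v} \<in> E \<longrightarrow> path_component (skeleton T) (f u) (f v)"
    using spanning_forest[OF _ finE] by auto
  have "finite R" using TR finV finite_subset by blast
  then have cT: "card T + 1 \<le> card V" using TR(3,4) card_gt_0_iff[of R] by linarith
  have "\<exists>Z. finite Z \<and> card Z \<ge> Suc (card (E - T)) \<and> Z \<inter> skeleton (T \<union> (E - T)) = {} \<and>
    (\<forall>a\<in>Z. \<forall>b\<in>Z. a \<noteq> b \<longrightarrow> \<not> connected_component (- skeleton (T \<union> (E - T))) a b)"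
    using finE TR by (intro separated_points) auto
  then obtain Z where Z: "finite Z" "card Z \<ge> Suc (card (E - T))" "Z \<inter> skeleton E = {}"
    "\<forall>a\<in>Z. \<forall>b\<in>Z. a \<noteq> b \<longrightarrow> \<not> connected_component (- skeleton E) a b"
    using TR(1) by (auto simp: Un_absorb1)
  let ?A = "\<lambda>e. {F \<in> ?Fs. borders e F}"
  have A: "finite (?A e)" "card (?A e) \<le> 2" if "e \<in> E" for e
  proof -
    obtain F1 F2 where s: "?A e \<subseteq> {F1, F2}" using edge_borders_two_faces[OF \<open>e \<in> E\<close>] by blast
    then show "finite (?A e)" by (rule finite_subset) simp
    have "card (?A e) \<le> card {F1, F2}" using s by (intro card_mono) auto
    also have "\<dots> \<le> 2" by (simp add: card_insert_if)
    finally show "card (?A e) \<le> 2" .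
  qed
  \<comment> \<open>Every face borders some edge and every edge borders finitely many faces, so
    there are finitely many faces.\<close>
  have "?Fs \<subseteq> (\<Union>e\<in>E. ?A e)"
  proof
    fix F assume F: "F \<in> ?Fs"
    then have "{e\<in>E. borders e F} \<noteq> {}" using face_borders_three_edges[OF True F] by force
    then show "F \<in> (\<Union>e\<in>E. ?A e)" using F by auto
  qed
  then have finF: "finite ?Fs" by (rule finite_subset) (use A finE in auto)
  have "inj_on (connected_component_set (- skeleton E)) Z"
  proof (rule inj_onI, rule ccontr)
    fix x y assume xy: "x \<in> Z" "y \<in> Z" "x \<noteq> y"
      "connected_component_set (- skeleton E) x = connected_component_set (- skeleton E) y"
    have "y \<in> connected_component_set (- skeleton E) y" using xy(2) Z(3) by (auto intro: connected_component_refl)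
    then have "connected_component (- skeleton E) x y" using xy(4) by auto
    then show False using xy Z(4) by blast
  qed
  then have "card Z = card (connected_component_set (- skeleton E) ` Z)" by (simp add: card_image)
  also have "\<dots> \<le> card ?Fs"
    using Z(3) finF by (intro card_mono) (auto intro!: componentsI)
  finally have cZ: "card Z \<le> card ?Fs" .
  have "3 * card ?Fs \<le> (\<Sum>F\<in>?Fs. card {e\<in>E. borders e F})"
    using sum_bounded_below[of ?Fs 3 "\<lambda>F. card {e\<in>E. borders e F}"] face_borders_three_edges[OF True]
    by (simp add: mult.commute)
  also have "\<dots> = (\<Sum>e\<in>E. card (?A e))"
    using sum_multicount_gen[OF finF finE, of "\<lambda>F e. borders e F"] by auto
  also have "\<dots> \<le> 2 * card E"
    using sum_bounded_above[of E "\<lambda>e. card (?A e)" 2] A by (simp add: mult.commute)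
  finally have "3 * card ?Fs \<le> 2 * card E" .
  moreover have "card (E - T) + card T = card E"
    using TR(1) finE by (metis add.commute card_Diff_subset card_mono finite_subset le_add_diff_inverse)
  ultimately show ?thesis using cZ Z(2) cT by linarith
qed

end

section \<open>Inversions of planar graphs\<close>

lemma plane_drawing_subgraph:
  assumes "plane_drawing V E f \<Gamma>" "V' \<subseteq> V" "E' \<subseteq> E" "\<And>e. e \<in> E' \<Longrightarrow> e \<subseteq> V'"
  shows "plane_drawing V' E' f \<Gamma>"
proof -
  interpret plane_drawing V E f \<Gamma> by fact
  show ?thesis
  proof
    show "finite V'" using finV assms(2) finite_subset by blast
    show "inj_on f V'" using inj_f assms(2) inj_on_subset by blast
    show "e \<subseteq> V' \<and> card e = 2" if "e \<in> E'" for e using EV assms that by blast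
    show "arc (\<Gamma> e)" if "e \<in> E'" for e using arc_edge assms(3) that by blast
    show "{pathstart (\<Gamma> e), pathfinish (\<Gamma> e)} = f ` e" if "e \<in> E'" for e
      using ends assms(3) that by blast
    show "v \<in> e" if "e \<in> E'" "v \<in> V'" "f v \<in> path_image (\<Gamma> e)" for e v
      using vertex_on_edge[of e v] assms(2,3) that by auto
    show "path_image (\<Gamma> e) \<inter> path_image (\<Gamma> e') \<subseteq> f ` (e \<inter> e')"
      if "e \<in> E'" "e' \<in> E'" "e \<noteq> e'" for e e'
      using edges_meet[of e e'] assms(3) that by auto
  qed
qed

lemma planar_imp_plane_drawing:
  fixes V :: "'a set"
  assumes "simple_graph V E" "planar V E"
  shows "\<exists>f \<Gamma>. plane_drawing V E f \<Gamma>"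
proof -
  obtain f :: "'a \<Rightarrow> complex" and \<Gamma> :: "'a set \<Rightarrow> real \<Rightarrow> complex" where d: "inj_on f V"
    "\<forall>e\<in>E. arc (\<Gamma> e) \<and> {pathstart (\<Gamma> e), pathfinish (\<Gamma> e)} = f ` e"
    "\<forall>e\<in>E. \<forall>v\<in>V. f v \<in> path_image (\<Gamma> e) \<longrightarrow> v \<in> e"
    "\<forall>e\<in>E. \<forall>e'\<in>E. e \<noteq> e' \<longrightarrow> path_image (\<Gamma> e) \<inter> path_image (\<Gamma> e') \<subseteq> f ` (e \<inter> e')"
    using assms(2) unfolding planar_def by (elim exE conjE) (rule that)
  have "plane_drawing V E f \<Gamma>"
    using assms(1) d by unfold_locales (simp_all add: simple_graph_def)
  then show ?thesis by blast
qed

text \<open>A vertex of degree at most k is placed last and the remaining vertices are ordered by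
  induction.\<close>

lemma degeneracy_ordering:
  assumes "finite V" "\<And>W. W \<subseteq> V \<Longrightarrow> W \<noteq> {} \<Longrightarrow> \<exists>v\<in>W. card {u\<in>W. {u,v} \<in> E} \<le> k"
  shows "\<exists>r :: 'a \<Rightarrow> nat. inj_on r V \<and> (\<forall>v\<in>V. card {u\<in>V. {u,v} \<in> E \<and> r u < r v} \<le> k)"
  using assms
proof (induction V rule: finite_psubset_induct)
  case (psubset V)
  show ?case
  proof (cases "V = {}")
    case False
    then obtain v where v: "v \<in> V" "card {u\<in>V. {u,v} \<in> E} \<le> k" using psubset.prems by blast
    have "V - {v} \<subset> V" using v by auto
    then have "\<exists>r :: 'a \<Rightarrow> nat. inj_on r (V - {v}) \<and>
        (\<forall>x\<in>V - {v}. card {u\<in>V - {v}. {u,x} \<in> E \<and> r u < r x} \<le> k)"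
      using psubset.prems by (intro psubset.IH) auto
    then obtain r :: "'a \<Rightarrow> nat" where r: "inj_on r (V - {v})"
      "\<And>x. x \<in> V - {v} \<Longrightarrow> card {u\<in>V - {v}. {u,x} \<in> E \<and> r u < r x} \<le> k" by blast
    \<comment> \<open>The successor of the sum exceeds every rank used so far.\<close>
    define s where "s = r(v := Suc (\<Sum>x\<in>V - {v}. r x))"
    have s: "s x < s v" if "x \<in> V - {v}" for x
      using that psubset.hyps by (auto simp: s_def less_Suc_eq_le intro: member_le_sum)
    have "inj_on s V"
    proof (rule inj_onI)
      fix x y assume xy: "x \<in> V" "y \<in> V" "s x = s y"
      show "x = y"
      proof (cases "x = v \<or> y = v")
        case True
        then show ?thesis using xy s[of x] s[of y] by (cases "x = y") auto
      next
        case False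
        then show ?thesis using xy r(1) by (auto simp: s_def dest: inj_onD)
      qed
    qed
    moreover have "card {u\<in>V. {u,x} \<in> E \<and> s u < s x} \<le> k" if x: "x \<in> V" for x
    proof (cases "x = v")
      case True
      have "card {u\<in>V. {u,v} \<in> E \<and> s u < s v} \<le> card {u\<in>V. {u,v} \<in> E}"
        using psubset.hyps by (intro card_mono) auto
      then show ?thesis using v True by simp
    next
      case False
      have "{u\<in>V. {u,x} \<in> E \<and> s u < s x} = {u\<in>V - {v}. {u,x} \<in> E \<and> r u < r x}"
        using s[of x] x False by (auto simp: s_def)
      then show ?thesis using r(2)[of x] x False by simp
    qed
    ultimately show ?thesis by blast
  qed auto
qed

text \<open>If all degrees in the induced subgraph were at least 6, it would have at least 3|W|
  edges, against Euler's bound 3|W| - 6.\<close>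

lemma planar_min_degree_le_5:
  assumes "plane_drawing V E f \<Gamma>" "W \<subseteq> V" "W \<noteq> {}"
  shows "\<exists>v\<in>W. card {u\<in>W. {u,v} \<in> E} \<le> 5"
proof (rule ccontr)
  assume neg: "\<not> ?thesis"
  define E' where "E' = {e\<in>E. e \<subseteq> W}"
  interpret plane_drawing W E' f \<Gamma>
    using assms(1,2) by (rule plane_drawing_subgraph) (auto simp: E'_def)
  have deg: "6 \<le> card {e\<in>E'. v \<in> e}" if v: "v \<in> W" for v
  proof -
    have "6 \<le> card {u\<in>W. {u,v} \<in> E}" using neg v by force
    also have "\<dots> = card ((\<lambda>u. {u,v}) ` {u\<in>W. {u,v} \<in> E})"
      by (intro card_image[symmetric]) (auto simp: inj_on_def doubleton_eq_iff)
    also have "\<dots> \<le> card {e\<in>E'. v \<in> e}"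
      using v finite_subset[OF _ finE, of "{e\<in>E'. v \<in> e}"] by (intro card_mono) (auto simp: E'_def)
    finally show ?thesis .
  qed
  \<comment> \<open>Six neighbours inside \<open>W\<close> already guarantee the three vertices that
    Euler's bound asks for.\<close>
  obtain v where v: "v \<in> W" using assms by blast
  have "6 \<le> card {u\<in>W. {u,v} \<in> E}" using neg v by force
  also have "\<dots> \<le> card W" using finV by (intro card_mono) auto
  finally have bound: "card E' + 6 \<le> 3 * card W" by (intro Euler_edge_bound) simp
  have "6 * card W \<le> (\<Sum>v\<in>W. card {e\<in>E'. v \<in> e})"
    using sum_bounded_below[of W 6 "\<lambda>v. card {e\<in>E'. v \<in> e}"] deg by (simp add: mult.commute)
  also have "\<dots> = (\<Sum>e\<in>E'. 2)"
  proof (rule sum_multicount_gen[OF finV finE])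
    show "\<forall>e\<in>E'. card {v\<in>W. v \<in> e} = 2"
    proof
      fix e assume "e \<in> E'"
      then have "e \<subseteq> W" "card e = 2" using EV by auto
      then show "card {v\<in>W. v \<in> e} = 2" by (simp add: Collect_conj_eq inf.absorb2)
    qed
  qed
  finally show False using bound by simp
qed

section \<open>From parities of flips to the inversion diameter\<close>

lemma mem_foldl_invert:
  "(u,v) \<in> foldl invert A Xs \<longleftrightarrow> (if even (flip_count Xs {u,v}) then (u,v) \<in> A else (v,u) \<in> A)"
proof (induction Xs arbitrary: A)
  case (Cons X Xs)
  have "(u,v) \<in> foldl invert A (X # Xs) \<longleftrightarrow>
      (if even (flip_count Xs {u,v}) then (u,v) \<in> invert A X else (v,u) \<in> invert A X)"
    by (simp add: Cons.IH)
  also have "\<dots> \<longleftrightarrow> (if even (flip_count (X # Xs) {u,v}) then (u,v) \<in> A else (v,u) \<in> A)"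
    by (auto simp: invert_def flip_count_def)
  finally show ?case .
qed (simp add: flip_count_def)

lemma inv_dist_le_of_flips:
  assumes "orientation E A1" "orientation E A2"
    and flips: "\<And>F. \<exists>Xs. length Xs = N \<and> (\<forall>X\<in>set Xs. X \<subseteq> V \<and> card X \<le> p) \<and>
                  (\<forall>e\<in>E. odd (flip_count Xs e) \<longleftrightarrow> e \<in> F)"
  shows "inv_dist p V A1 A2 \<le> N"
proof -
  \<comment> \<open>The edges on which the two orientations disagree are exactly those to be
    reversed an odd number of times.\<close>
  define F where "F = {{u,v} | u v. (u,v) \<in> A1 \<and> (u,v) \<notin> A2}"
  have or: "(u,v) \<in> A \<Longrightarrow> {u,v} \<in> E" "{u,v} \<in> E \<Longrightarrow> (v,u) \<in> A \<longleftrightarrow> (u,v) \<notin> A"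
    if "orientation E A" for A u v
    using that unfolding orientation_def by (blast, metis)
  have F: "{u,v} \<in> F \<longleftrightarrow> ((u,v) \<in> A1 \<longleftrightarrow> (u,v) \<notin> A2)" if "{u,v} \<in> E" for u v
  proof -
    have "{u,v} \<in> F \<longleftrightarrow> (u,v) \<in> A1 \<and> (u,v) \<notin> A2 \<or> (v,u) \<in> A1 \<and> (v,u) \<notin> A2"
      by (auto simp: F_def doubleton_eq_iff)
    then show ?thesis using or(2)[OF assms(1) that] or(2)[OF assms(2) that] by blast
  qed
  obtain Xs where Xs: "length Xs = N" "\<forall>X\<in>set Xs. X \<subseteq> V \<and> card X \<le> p"
    "\<forall>e\<in>E. odd (flip_count Xs e) \<longleftrightarrow> e \<in> F" using flips[of F] by (elim exE conjE) (rule that)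
  have "(u,v) \<in> foldl invert A1 Xs \<longleftrightarrow> (u,v) \<in> A2" for u v
  proof (cases "{u,v} \<in> E")
    case True
    then show ?thesis
      using F[OF True] Xs(3) or(2)[OF assms(1) True] by (auto simp: mem_foldl_invert)
  next
    case False
    then have "(u,v) \<notin> A1" "(v,u) \<notin> A1" "(u,v) \<notin> A2"
      using or(1)[OF assms(1)] or(1)[OF assms(2)] by (metis insert_commute)+
    then show ?thesis by (simp add: mem_foldl_invert)
  qed
  then have "foldl invert A1 Xs = A2" by auto
  then show ?thesis unfolding inv_dist_def using Xs(1,2) by (intro Least_le) blast
qed

lemma inv_diam_planar:
  assumes "simple_graph V E" "planar V E" "q \<ge> 1" "2 * q \<le> p" "card E \<le> q * M"
  shows "inv_diam p V E \<le> M + 5 * (q - 1)"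
proof -
  obtain f \<Gamma> where draw: "plane_drawing V E f \<Gamma>"
    using planar_imp_plane_drawing[OF assms(1,2)] by blast
  then interpret plane_drawing V E f \<Gamma> .
  obtain r :: "'a \<Rightarrow> nat" where r: "inj_on r V"
    "\<And>v. v \<in> V \<Longrightarrow> card {u\<in>V. {u,v} \<in> E \<and> r u < r v} \<le> 5"
    using degeneracy_ordering[OF finV planar_min_degree_le_5[OF draw]] by blast
  have sub: "{u. {u,v} \<in> E \<and> r u < r v} = {u\<in>V. {u,v} \<in> E \<and> r u < r v}" for v
    using EV by auto
  have flips: "\<exists>Xs. length Xs = M + 5 * (q - 1) \<and> (\<forall>X\<in>set Xs. X \<subseteq> V \<and> card X \<le> p) \<and>
              (\<forall>e\<in>E. odd (flip_count Xs e) \<longleftrightarrow> e \<in> F)" for F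
  proof -
    have "\<exists>Xs. length Xs = M + 5 * (q - 1) \<and> (\<forall>X\<in>set Xs. X \<subseteq> V \<and> card X \<le> 2 * q) \<and>
              (\<forall>e\<in>E. odd (flip_count Xs e) \<longleftrightarrow> e \<in> F)"
      by (rule flips_of_degenerate_graph[OF assms(1) r(1) assms(3) _ assms(5)]) (simp add: sub r(2))
    then obtain Xs where "length Xs = M + 5 * (q - 1)" "\<forall>X\<in>set Xs. X \<subseteq> V \<and> card X \<le> 2 * q"
      "\<forall>e\<in>E. odd (flip_count Xs e) \<longleftrightarrow> e \<in> F" by (elim exE conjE) (rule that)
    then show ?thesis using assms(4) by (intro exI[of _ Xs]) fastforce
  qed
  let ?S = "{inv_dist p V A1 A2 | A1 A2. orientation E A1 \<and> orientation E A2}"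
  \<comment> \<open>\<open>Max\<close> needs a finite nonempty set: there are finitely many
    orientations, and directing each edge by increasing \<open>r\<close> gives one.\<close>
  have "{A. orientation E A} \<subseteq> Pow (V \<times> V)"
    using EV by (fastforce simp: orientation_def)
  then have "finite {A. orientation E A}" using finV by (meson finite_Pow_iff finite_SigmaI finite_subset)
  moreover have "?S = (\<lambda>(A1,A2). inv_dist p V A1 A2) ` ({A. orientation E A} \<times> {A. orientation E A})"
    by auto
  ultimately have "finite ?S" by simp
  moreover have "?S \<noteq> {}"
  proof -
    have "orientation E {(u,v). {u,v} \<in> E \<and> r u < r v}"
    proof -
      have "r u < r v \<longleftrightarrow> \<not> r v < r u" if "{u,v} \<in> E" for u v
      proof -
        have "u \<in> V" "v \<in> V" "u \<noteq> v" using EV[OF that] by auto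
        then have "r u \<noteq> r v" using r(1) by (auto dest: inj_onD)
        then show ?thesis by auto
      qed
      moreover have "{v,u} \<in> E" if "{u,v} \<in> E" for u v using that by (simp add: insert_commute)
      ultimately show ?thesis
        unfolding orientation_def mem_Collect_eq prod.case by (intro conjI allI impI) blast+
    qed
    then show ?thesis by blast
  qed
  moreover have "\<forall>d\<in>?S. d \<le> M + 5 * (q - 1)" using inv_dist_le_of_flips[OF _ _ flips] by blast
  ultimately show ?thesis unfolding inv_diam_def by (intro Max.boundedI) blast+
qed

theorem mainTheorem7:
  fixes p :: nat and V :: "'a set" and E :: "'a set set"
  assumes "p \<ge> 2" and "simple_graph V E" and "planar V E"
  shows "int (inv_diam p V E) \<le>
           \<lceil>real (card E) / real (p div 2)\<rceil> + 8 * int (p div 2) - 8 \<and>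
         (card V \<ge> 3 \<longrightarrow> int (inv_diam p V E) \<le>
           \<lceil>(3 * real (card V) - 6) / real (p div 2)\<rceil> + 8 * int (p div 2) - 8)"
proof -
  define q where "q = p div 2"
  have q: "q \<ge> 1" "2 * q \<le> p" using assms(1) by (auto simp: q_def)
  define M where "M = nat \<lceil>real (card E) / real q\<rceil>"
  have M: "int M = \<lceil>real (card E) / real q\<rceil>" 
  proof -
    have "0 \<le> real (card E) / real q" by simp
    then have "0 \<le> \<lceil>real (card E) / real q\<rceil>" by linarith
    then show ?thesis by (simp add: M_def)
  qed
  have "real (card E) / real q \<le> real M" unfolding M_def by (rule real_nat_ceiling_ge)
  then have "real (card E) \<le> real (q * M)" using q by (simp add: field_simps)
  then have "card E \<le> q * M" by (simp only: of_nat_le_iff)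
  then have "inv_diam p V E \<le> M + 5 * (q - 1)"
    using inv_diam_planar assms q by blast
  \<comment> \<open>Since q is at least 1, the surplus 5 * (q - 1) is at most 8 * q - 8.\<close>
  then have main: "int (inv_diam p V E) \<le> \<lceil>real (card E) / real q\<rceil> + 8 * int q - 8"
    using q M by linarith
  moreover have "\<lceil>real (card E) / real q\<rceil> \<le> \<lceil>(3 * real (card V) - 6) / real q\<rceil>" if "card V \<ge> 3"
  proof -
    obtain f \<Gamma> where "plane_drawing V E f \<Gamma>" using planar_imp_plane_drawing[OF assms(2,3)] by blast
    then have "card E + 6 \<le> 3 * card V" using that by (rule plane_drawing.Euler_edge_bound)
    then have "real (card E) \<le> 3 * real (card V) - 6" by linarith
    then show ?thesis by (intro ceiling_mono divide_right_mono) auto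
  qed
  ultimately show ?thesis unfolding q_def[symmetric] by force
qed

end
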